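(* Let $0<\omega<+\infty$, let $A:[0,\omega]\to\mathbb{R}^{n\times n}$, $B:[0,\omega]\to\mathbb{R}^{n\times r}$, $H:[0,\omega]\to\mathbb{R}^{m\times n}$ be continuous matrix-valued functions, and let $\ell\in\mathbb{L}_2([0,\omega],\mathbb{R}^n)$. Then the boundary value problem $$\dot z(t)=-A'(t)z(t)+H'(t)H(t)p(t)-\ell(t),$$ $$\dot p(t)=A(t)p(t)+B(t)B'(t)z(t),$$ $$z(0)=z(\omega),\qquad p(0)=p(\omega)$$ has at least one solution $(z,p)$ if and only if $$P\,h(\omega)\perp\mathscr{N}(W(0,\omega)),$$ where $$P:=E-(E-\Phi(\omega,0))(E-\Phi(\omega,0))^{+},$$ $$W(0,\omega):=\int_0^\omega P\,\Phi(\omega,s)H'(s)H(s)\Phi'(\omega,s)P\,ds,$$ and $h$ is the solution of $\dot h(t)=-A'(t)h(t)+\ell(t)$, $h(0)=0$.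
   Context: A prime denotes the matrix transpose, $E$ is the $n\times n$ identity matrix, $M^{+}$ is the Moore–Penrose pseudoinverse of a matrix $M$, $\mathscr{N}(M)$ is the null space of $M$, and $\perp$ is orthogonality in $\mathbb{R}^n$. $\Phi(t,s)$ is the fundamental matrix of $\dot z(t)=-A'(t)z(t)$, i.e. $\partial_t\Phi(t,s)=-A'(t)\Phi(t,s)$, $\Phi(s,s)=E$; $\Phi'(\omega,s)$ is the transpose of $\Phi(\omega,s)$. Solutions of differential equations are absolutely continuous functions on $[0,\omega]$ satisfying the equations almost everywhere. *)

theory Defs
  imports "HOL-Analysis.Analysis"
begin

section \<open>Matrices\<close>

definition null_space :: "real^'n^'m \<Rightarrow> (real^'n) set" where
  "null_space M = {v. M *v v = 0}"

definition is_pseudoinverse :: "real^'n^'m \<Rightarrow> real^'m^'n \<Rightarrow> bool" where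
  "is_pseudoinverse M X \<longleftrightarrow>
     M ** X ** M = M \<and> X ** M ** X = X \<and>
     transpose (M ** X) = M ** X \<and> transpose (X ** M) = X ** M"

definition pseudoinverse :: "real^'n^'m \<Rightarrow> real^'m^'n" where
  "pseudoinverse M = (THE X. is_pseudoinverse M X)"

text \<open>The Penrose equations have exactly one solution, so the description above denotes it.\<close>

lemma is_pseudoinverse_unique:
  fixes M :: "real^'n^'m"
  assumes X: "is_pseudoinverse M X" and Y: "is_pseudoinverse M Y"
  shows "X = Y"
proof -
  have x1: "M ** X ** M = M" and x2: "X ** M ** X = X"
    and x3: "transpose (M ** X) = M ** X" and x4: "transpose (X ** M) = X ** M"
    using X unfolding is_pseudoinverse_def by auto
  have y1: "M ** Y ** M = M" and y2: "Y ** M ** Y = Y"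
    and y3: "transpose (M ** Y) = M ** Y" and y4: "transpose (Y ** M) = Y ** M"
    using Y unfolding is_pseudoinverse_def by auto
  have "M ** X = transpose ((M ** Y) ** (M ** X))"
    using x3 y1 by (simp add: matrix_mul_assoc)
  also have "\<dots> = (M ** X) ** (M ** Y)"
    by (simp only: matrix_transpose_mul[of "M ** Y" "M ** X"] x3 y3)
  also have "\<dots> = M ** Y"
    using x1 by (simp add: matrix_mul_assoc)
  finally have a: "M ** X = M ** Y" .
  have "X ** M = transpose ((X ** M) ** (Y ** M))"
    using x4 y1 by (metis matrix_mul_assoc)
  also have "\<dots> = (Y ** M) ** (X ** M)"
    by (simp only: matrix_transpose_mul[of "X ** M" "Y ** M"] x4 y4)
  also have "\<dots> = Y ** M"
    using x1 by (metis matrix_mul_assoc)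
  finally have b: "X ** M = Y ** M" .
  have "X = X ** (M ** X)" using x2 by (simp add: matrix_mul_assoc)
  also have "\<dots> = X ** M ** Y" using a by (simp add: matrix_mul_assoc)
  also have "\<dots> = Y" using b y2 by simp
  finally show ?thesis .
qed

lemma exists_inner_inverse:
  fixes M :: "real^'n^'m"
  obtains G :: "real^'m^'n" where "M ** G ** M = M"
proof -
  obtain g where g: "linear g" "\<forall>v\<in>range (\<lambda>x. M *v x). M *v (g v) = v"
    using linear_exists_right_inverse_on[of "\<lambda>x. M *v x" UNIV]
    by auto
  have "M ** matrix g ** M = M"
    unfolding matrix_eq
    using g by (simp add: matrix_vector_mul_assoc[symmetric] matrix_works)
  then show ?thesis using that by blast
qed

lemma gram_cancel:
  fixes M :: "real^'n^'m" and Y Z :: "real^'k^'n"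
  assumes "transpose M ** M ** Y = transpose M ** M ** Z"
  shows "M ** Y = M ** Z"
  unfolding matrix_eq
proof
  fix x
  define w where "w = Y *v x - Z *v x"
  have "transpose M *v (M *v w) = 0"
    unfolding w_def matrix_vector_mult_diff_distrib
    using arg_cong[OF assms, of "\<lambda>T. T *v x"]
    by (simp add: matrix_vector_mul_assoc matrix_mul_assoc)
  moreover have "(M *v w) \<bullet> (M *v w) = (transpose M *v (M *v w)) \<bullet> w"
    by (simp add: dot_lmul_matrix)
  ultimately have "M *v w = 0"
    by simp
  then show "M ** Y *v x = M ** Z *v x"
    unfolding w_def matrix_vector_mult_diff_distrib
    by (simp add: matrix_vector_mul_assoc)
qed

lemma exists_range_projection:
  fixes M :: "real^'n^'m"
  obtains G :: "real^'n^'n"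
  where "M ** G ** transpose M ** M = M"
    and "transpose (M ** G ** transpose M) = M ** G ** transpose M"
proof -
  obtain G :: "real^'n^'n" where G: "(transpose M ** M) ** G ** (transpose M ** M) = transpose M ** M"
    using exists_inner_inverse by blast
  define Q where "Q = M ** G ** transpose M"
  have "M ** (G ** transpose M ** M) = M ** mat 1"
    by (rule gram_cancel) (use G in \<open>simp add: matrix_mul_assoc\<close>)
  then have QM: "Q ** M = M"
    by (simp add: Q_def matrix_mul_assoc)
  have MQ: "transpose M ** transpose Q = transpose M"
    using QM by (metis matrix_transpose_mul)
  have "Q ** transpose Q = Q"
    unfolding Q_def using MQ by (metis Q_def matrix_mul_assoc)
  then have "transpose Q = Q"
    by (metis matrix_transpose_mul transpose_transpose)
  then show ?thesis using that QM unfolding Q_def by blast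
qed

lemma is_pseudoinverse_pseudoinverse: "is_pseudoinverse M (pseudoinverse M)"
proof -
  obtain G where G: "M ** G ** transpose M ** M = M"
      "transpose (M ** G ** transpose M) = M ** G ** transpose M"
    using exists_range_projection by blast
  obtain K where K: "transpose M ** K ** M ** transpose M = transpose M"
      "transpose (transpose M ** K ** M) = transpose M ** K ** M"
    using exists_range_projection[of "transpose M"] by (metis transpose_transpose)
  define X where "X = transpose M ** K ** M ** G ** transpose M"
  have "transpose (transpose M ** K ** M ** transpose M) = M ** (transpose M ** K ** M)"
    using K(2) by (simp only: matrix_transpose_mul[of _ "transpose M"] transpose_transpose)
  then have R: "M ** (transpose M ** K ** M) = M"
    using K(1) by simp
  have MX: "M ** X = M ** G ** transpose M"
    unfolding X_def using R by (simp add: matrix_mul_assoc)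
  have XM: "X ** M = transpose M ** K ** M"
    unfolding X_def using G(1) by (metis matrix_mul_assoc)
  have "is_pseudoinverse M X"
    unfolding is_pseudoinverse_def
  proof (intro conjI)
    show "M ** X ** M = M" using MX G(1) by simp
    show "X ** M ** X = X"
      unfolding XM using K(1) by (simp add: X_def matrix_mul_assoc)
    show "transpose (M ** X) = M ** X" using MX G(2) by simp
    show "transpose (X ** M) = X ** M" using XM K(2) by simp
  qed
  then show ?thesis
    unfolding pseudoinverse_def by (metis is_pseudoinverse_unique theI)
qed


section \<open>Solutions of differential equations\<close>

definition absolutely_continuous_between :: "real \<Rightarrow> real \<Rightarrow> (real \<Rightarrow> 'a::real_normed_vector) \<Rightarrow> bool" where
  "absolutely_continuous_between a b f \<longleftrightarrow>
     (\<forall>\<epsilon>>0. \<exists>\<delta>>0. \<forall>(N::nat) (u::nat \<Rightarrow> real) (v::nat \<Rightarrow> real).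
        (\<forall>i<N. a \<le> u i \<and> u i \<le> v i \<and> v i \<le> b) \<longrightarrow>
        (\<forall>i<N. \<forall>j<N. i \<noteq> j \<longrightarrow> {u i<..<v i} \<inter> {u j<..<v j} = {}) \<longrightarrow>
        (\<Sum>i<N. v i - u i) < \<delta> \<longrightarrow>
        (\<Sum>i<N. norm (f (v i) - f (u i))) < \<epsilon>)"

text \<open>\<open>x' = f\<close> in the sense of Caratheodory; for a differential equation, \<open>f\<close> is its right-hand
  side evaluated along the solution.\<close>

definition ae_solution :: "real \<Rightarrow> real \<Rightarrow> (real \<Rightarrow> 'a::real_normed_vector) \<Rightarrow> (real \<Rightarrow> 'a) \<Rightarrow> bool" where
  "ae_solution a b x f \<longleftrightarrow>
     absolutely_continuous_between a b x \<and>
     (AE t in lebesgue_on {a..b}. (x has_vector_derivative f t) (at t within {a..b}))"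

definition square_integrable_between :: "real \<Rightarrow> real \<Rightarrow> (real \<Rightarrow> 'a::euclidean_space) \<Rightarrow> bool" where
  "square_integrable_between a b f \<longleftrightarrow>
     f \<in> borel_measurable (lebesgue_on {a..b}) \<and>
     integrable (lebesgue_on {a..b}) (\<lambda>t. (norm (f t))\<^sup>2)"

text \<open>\<open>\<Phi> t s\<close> is only constrained for both arguments in the interval, where \<open>A\<close> is given; the
  one-sided derivative is meant at the endpoints.\<close>

definition fundamental_matrix ::
    "real \<Rightarrow> real \<Rightarrow> (real \<Rightarrow> real^'n^'n) \<Rightarrow> (real \<Rightarrow> real \<Rightarrow> real^'n^'n) \<Rightarrow> bool" where
  "fundamental_matrix a b C \<Phi> \<longleftrightarrow>
     (\<forall>s\<in>{a..b}. \<Phi> s s = mat 1 \<and>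
        (\<forall>t\<in>{a..b}. ((\<lambda>\<tau>. \<Phi> \<tau> s) has_vector_derivative C t ** \<Phi> t s) (at t within {a..b})))"

end

theory Submission
  imports Defs
begin

text \<open>Put \<open>y = z + h\<close>: the forcing \<open>l\<close> disappears from the first equation, and because the remaining
  right-hand side is continuous, \<open>y\<close> is a classical solution although \<open>z\<close> is only absolutely
  continuous. The problem becomes a linear Hamiltonian system for \<open>(y, p)\<close> with prescribed jump
  \<open>(h \<omega>, 0)\<close>. Such a system is formally self-adjoint, so by the Fredholm alternative the obstructions
  are its periodic homogeneous solutions \<open>(\<zeta>, \<pi>)\<close>. For these, \<open>(\<zeta> \<bullet> \<pi>)' = |H \<pi>|\<^sup>2 + |B' \<zeta>|\<^sup>2\<close> integrates
  to zero, hence \<open>H \<pi> = 0\<close>, \<open>B' \<zeta> = 0\<close> and \<open>\<pi>' = A \<pi>\<close>, i.e. \<open>\<pi> s\<close> is the transpose of \<open>\<Phi> \<omega> s\<close> applied to a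
  vector \<open>q\<close> in the range of \<open>P\<close>. The condition \<open>H \<pi> = 0\<close> says that \<open>q\<close> lies in the null space of the
  Gramian \<open>W\<close>, and the solvability condition reads \<open>h \<omega> \<bullet> q = 0\<close>.\<close>

section \<open>Absolutely continuous solutions\<close>

text \<open>Absolute continuity is split at its outer quantifiers: this predicate says that \<delta>
  serves for one fixed \<epsilon>, so that a witness can be passed between intervals and sums by
  introduction and destruction rules.\<close>

definition ac_modulus :: "real \<Rightarrow> real \<Rightarrow> (real \<Rightarrow> 'a::real_normed_vector) \<Rightarrow> real \<Rightarrow> real \<Rightarrow> bool" where
  "ac_modulus a b f \<epsilon> \<delta> \<longleftrightarrow> 0 < \<delta> \<and> (\<forall>(N::nat) u v. (\<forall>i<N. a \<le> u i \<and> u i \<le> v i \<and> v i \<le> b) \<longrightarrow>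
      (\<forall>i<N. \<forall>j<N. i \<noteq> j \<longrightarrow> {u i<..<v i} \<inter> {u j<..<v j} = {}) \<longrightarrow>
      (\<Sum>i<N. v i - u i) < \<delta> \<longrightarrow> (\<Sum>i<N. norm (f (v i) - f (u i))) < \<epsilon>)"

lemma absolutely_continuous_between_iff_modulus:
  "absolutely_continuous_between a b f \<longleftrightarrow> (\<forall>\<epsilon>>0. \<exists>\<delta>. ac_modulus a b f \<epsilon> \<delta>)"
  unfolding absolutely_continuous_between_def ac_modulus_def by blast

lemma ac_modulusI:
  fixes f :: "real \<Rightarrow> 'a::real_normed_vector"
  assumes "0 < \<delta>"
    and "\<And>(N::nat) u v. \<lbrakk>\<forall>i<N. a \<le> u i \<and> u i \<le> v i \<and> v i \<le> b;
      \<forall>i<N. \<forall>j<N. i \<noteq> j \<longrightarrow> {u i<..<v i} \<inter> {u j<..<v j} = {};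
      (\<Sum>i<N. v i - u i) < \<delta>\<rbrakk> \<Longrightarrow> (\<Sum>i<N. norm (f (v i) - f (u i))) < \<epsilon>"
  shows "ac_modulus a b f \<epsilon> \<delta>"
  using assms unfolding ac_modulus_def by blast

lemma ac_modulusD:
  assumes "ac_modulus a b f \<epsilon> \<delta>" "\<forall>i<(N::nat). a \<le> u i \<and> u i \<le> v i \<and> v i \<le> b"
    "\<forall>i<N. \<forall>j<N. i \<noteq> j \<longrightarrow> {u i<..<v i} \<inter> {u j<..<v j} = {}" "(\<Sum>i<N. v i - u i) < \<delta>"
  shows "(\<Sum>i<N. norm (f (v i) - f (u i))) < \<epsilon>"
  using assms unfolding ac_modulus_def by blast

lemma ac_modulus_pos: "ac_modulus a b f \<epsilon> \<delta> \<Longrightarrow> 0 < \<delta>"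
  by (simp add: ac_modulus_def)

lemma absolutely_continuous_between_subinterval:
  assumes f: "absolutely_continuous_between a b f" and cd: "a \<le> c" "d \<le> b"
  shows "absolutely_continuous_between c d f"
  unfolding absolutely_continuous_between_iff_modulus
proof (intro allI impI)
  fix \<epsilon> :: real assume "0 < \<epsilon>"
  then obtain \<delta> where \<delta>: "ac_modulus a b f \<epsilon> \<delta>"
    using f unfolding absolutely_continuous_between_iff_modulus by blast
  have "ac_modulus c d f \<epsilon> \<delta>"
  proof (rule ac_modulusI[OF ac_modulus_pos[OF \<delta>]])
    fix N :: nat and u v :: "nat \<Rightarrow> real"
    assume uv: "\<forall>i<N. c \<le> u i \<and> u i \<le> v i \<and> v i \<le> d"
      "\<forall>i<N. \<forall>j<N. i \<noteq> j \<longrightarrow> {u i<..<v i} \<inter> {u j<..<v j} = {}"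
      "(\<Sum>i<N. v i - u i) < \<delta>"
    have "\<forall>i<N. a \<le> u i \<and> u i \<le> v i \<and> v i \<le> b" using uv(1) cd by force
    then show "(\<Sum>i<N. norm (f (v i) - f (u i))) < \<epsilon>" by (rule ac_modulusD[OF \<delta> _ uv(2,3)])
  qed
  then show "\<exists>\<delta>. ac_modulus c d f \<epsilon> \<delta>" by blast
qed

lemma absolutely_continuous_between_add:
  assumes f: "absolutely_continuous_between a b f" and g: "absolutely_continuous_between a b g"
  shows "absolutely_continuous_between a b (\<lambda>t. f t + g t)"
  unfolding absolutely_continuous_between_iff_modulus
proof (intro allI impI)
  fix \<epsilon> :: real assume "0 < \<epsilon>"
  then have e: "\<epsilon>/2 > 0" by simp
  obtain d1 where d1: "ac_modulus a b f (\<epsilon>/2) d1"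
    using f e unfolding absolutely_continuous_between_iff_modulus by blast
  obtain d2 where d2: "ac_modulus a b g (\<epsilon>/2) d2"
    using g e unfolding absolutely_continuous_between_iff_modulus by blast
  have "ac_modulus a b (\<lambda>t. f t + g t) \<epsilon> (min d1 d2)"
  proof (rule ac_modulusI)
    fix N :: nat and u v :: "nat \<Rightarrow> real"
    assume uv: "\<forall>i<N. a \<le> u i \<and> u i \<le> v i \<and> v i \<le> b"
      "\<forall>i<N. \<forall>j<N. i \<noteq> j \<longrightarrow> {u i<..<v i} \<inter> {u j<..<v j} = {}"
      "(\<Sum>i<N. v i - u i) < min d1 d2"
    have "(\<Sum>i<N. norm (f (v i) + g (v i) - (f (u i) + g (u i))))
        \<le> (\<Sum>i<N. norm (f (v i) - f (u i)) + norm (g (v i) - g (u i)))"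
      by (intro sum_mono norm_diff_triangle_ineq)
    also have "\<dots> < \<epsilon>"
      using ac_modulusD[OF d1 uv(1,2)] ac_modulusD[OF d2 uv(1,2)] uv(3) by (simp add: sum.distrib)
    finally show "(\<Sum>i<N. norm (f (v i) + g (v i) - (f (u i) + g (u i)))) < \<epsilon>" .
  qed (use d1 d2 in \<open>auto simp: ac_modulus_pos\<close>)
  then show "\<exists>\<delta>. ac_modulus a b (\<lambda>t. f t + g t) \<epsilon> \<delta>" by blast
qed

lemma absolutely_continuous_between_minus:
  assumes "absolutely_continuous_between a b f"
  shows "absolutely_continuous_between a b (\<lambda>t. - f t)"
  using assms unfolding absolutely_continuous_between_def
  by (simp add: norm_minus_commute add.commute)

lemma absolutely_continuous_between_diff:
  assumes "absolutely_continuous_between a b f" "absolutely_continuous_between a b g"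
  shows "absolutely_continuous_between a b (\<lambda>t. f t - g t)"
  using absolutely_continuous_between_add[OF assms(1) absolutely_continuous_between_minus[OF assms(2)]]
  by simp

lemma absolutely_continuous_between_lipschitz:
  assumes f: "\<And>s t. a \<le> s \<Longrightarrow> s \<le> t \<Longrightarrow> t \<le> b \<Longrightarrow> norm (f t - f s) \<le> K * (t - s)"
  shows "absolutely_continuous_between a b f"
  unfolding absolutely_continuous_between_iff_modulus
proof (intro allI impI)
  fix \<epsilon> :: real assume e: "0 < \<epsilon>"
  \<comment> \<open>\<open>K\<close> may be zero or negative; \<open>L\<close> is a positive
    Lipschitz constant by which \<epsilon> can be divided.\<close>
  define L where "L = max K 1"
  have L: "L > 0" "K \<le> L" by (auto simp: L_def)
  have "ac_modulus a b f \<epsilon> (\<epsilon> / L)"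
  proof (rule ac_modulusI)
    fix N :: nat and u v :: "nat \<Rightarrow> real"
    assume uv: "\<forall>i<N. a \<le> u i \<and> u i \<le> v i \<and> v i \<le> b" "(\<Sum>i<N. v i - u i) < \<epsilon> / L"
    have "norm (f (v i) - f (u i)) \<le> L * (v i - u i)" if "i < N" for i
    proof -
      have "norm (f (v i) - f (u i)) \<le> K * (v i - u i)" using f uv(1) that by auto
      also have "\<dots> \<le> L * (v i - u i)" using L(2) uv(1) that by (intro mult_right_mono) auto
      finally show ?thesis .
    qed
    then have "(\<Sum>i<N. norm (f (v i) - f (u i))) \<le> (\<Sum>i<N. L * (v i - u i))"
      by (intro sum_mono) auto
    also have "\<dots> < \<epsilon>"
      using uv(2) L(1) by (simp only: sum_distrib_left[symmetric]) (simp add: pos_less_divide_eq mult.commute)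
    finally show "(\<Sum>i<N. norm (f (v i) - f (u i))) < \<epsilon>" .
  qed (use e L in auto)
  then show "\<exists>\<delta>. ac_modulus a b f \<epsilon> \<delta>" by blast
qed

lemma absolutely_continuous_between_imp_continuous_on:
  assumes "absolutely_continuous_between a b f"
  shows "continuous_on {a..b} f"
  unfolding continuous_on_iff
proof (intro ballI allI impI)
  fix x and \<epsilon> :: real assume x: "x \<in> {a..b}" and "0 < \<epsilon>"
  then obtain d where d: "ac_modulus a b f \<epsilon> d"
    using assms unfolding absolutely_continuous_between_iff_modulus by blast
  have "dist (f y) (f x) < \<epsilon>" if y: "y \<in> {a..b}" and yx: "dist y x < d" for y
    \<comment> \<open>A family of one interval suffices; \<open>min\<close> and \<open>max\<close>
      treat both orders of the two points at once.\<close>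
    using ac_modulusD[OF d, of 1 "\<lambda>_. min x y" "\<lambda>_. max x y"] x y yx
    by (auto simp: dist_norm min_def max_def abs_if norm_minus_commute split: if_splits)
  with ac_modulus_pos[OF d] show "\<exists>d>0. \<forall>y\<in>{a..b}. dist y x < d \<longrightarrow> dist (f y) (f x) < \<epsilon>"
    by blast
qed

lemma absolutely_continuous_between_C1:
  fixes f :: "real \<Rightarrow> 'a::real_normed_vector"
  assumes f: "\<And>t. t \<in> {a..b} \<Longrightarrow> (f has_vector_derivative f' t) (at t within {a..b})"
    and f': "continuous_on {a..b} f'"
  shows "absolutely_continuous_between a b f"
proof -
  obtain K where K: "\<And>t. t \<in> {a..b} \<Longrightarrow> norm (f' t) \<le> K"
    using compact_imp_bounded[OF compact_continuous_image[OF f' compact_Icc]]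
    unfolding bounded_iff by fastforce
  show ?thesis
  proof (rule absolutely_continuous_between_lipschitz)
    fix s t assume st: "a \<le> s" "s \<le> t" "t \<le> b"
    have "norm (f t - f s) \<le> K * norm (t - s)"
    proof (rule differentiable_bound[where S = "{a..b}" and f' = "\<lambda>t h. h *\<^sub>R f' t"])
      show "onorm (\<lambda>h. h *\<^sub>R f' x) \<le> K" if "x \<in> {a..b}" for x
        using K[OF that] by (intro onorm_le) (simp add: mult.commute[of K] mult_left_mono)
    qed (use st f in \<open>auto simp: has_vector_derivative_def\<close>)
    then show "norm (f t - f s) \<le> K * (t - s)" using st by simp
  qed
qed

text \<open>Cells of a tagged partial division meet only in their boundaries, so their interiors are
  disjoint, have the same lengths, and all fit into \<open>G\<close>. This bounds the total length
  of the cells tagged in a null set.\<close>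

lemma sum_content_le_measure:
  assumes p: "p tagged_partial_division_of (S::real set)" and fin: "finite p"
    and sub: "\<And>x k. (x, k) \<in> p \<Longrightarrow> k \<subseteq> G" and G: "G \<in> lmeasurable"
  shows "(\<Sum>(x, k)\<in>p. measure lborel k) \<le> measure lebesgue G"
proof -
  let ?I = "\<lambda>(x::real, k::real set). interior k"
  have box: "\<exists>a b. k = {a..b}" if "(x, k) \<in> p" for x k
    using tagged_partial_division_ofD(4)[OF p that] by auto
  have I: "?I q \<in> lmeasurable" "measure lebesgue (?I q) = measure lborel (snd q)" if "q \<in> p" for q
    using box[of "fst q" "snd q"] that by (auto simp: split_beta)
  have "(\<Sum>(x, k)\<in>p. measure lborel k) = (\<Sum>q\<in>p. measure lebesgue (?I q))"
    using I by (intro sum.cong) auto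
  also have "\<dots> = measure lebesgue (\<Union>q\<in>p. ?I q)"
  proof (rule measure_finite_Union[symmetric, OF fin])
    show "disjoint_family_on ?I p"
      using tagged_partial_division_ofD(5)[OF p] unfolding disjoint_family_on_def by fastforce
    show "?I ` p \<subseteq> sets lebesgue" using I(1) fmeasurableD by blast
    show "emeasure lebesgue (?I q) \<noteq> \<infinity>" if "q \<in> p" for q
      using fmeasurableD2[OF I(1)[OF that]] by simp
  qed
  also have "\<dots> \<le> measure lebesgue G"
  proof (rule measure_mono_fmeasurable[OF _ _ G])
    show "(\<Union>q\<in>p. ?I q) \<subseteq> G" using sub interior_subset by fastforce
    show "(\<Union>q\<in>p. ?I q) \<in> sets lebesgue" using I(1) fin fmeasurableD by blast
  qed
  finally show ?thesis .
qed

text \<open>Cousin's lemma: over the tags in the exceptional null set the increments are controlled by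
  absolute continuity, over the remaining tags by the vanishing derivative.\<close>

lemma absolutely_continuous_ae_zero_derivative_eq:
  fixes f :: "real \<Rightarrow> 'a::real_normed_vector"
  assumes "a \<le> b" and ac: "absolutely_continuous_between a b f"
    and N: "negligible N"
    and f: "\<And>t. t \<in> {a..b} - N \<Longrightarrow> (f has_vector_derivative 0) (at t within {a..b})"
  shows "f b = f a"
proof -
  \<comment> \<open>The summand \<open>e\<close> will come from the cells tagged in
    \<open>N\<close>, the summand \<open>e * (b - a)\<close> from all others.\<close>
  have "norm (f b - f a) \<le> e * (1 + (b - a))" if e: "e > 0" for e
  proof -
    obtain \<delta> where \<delta>: "ac_modulus a b f e \<delta>"
      using ac e unfolding absolutely_continuous_between_iff_modulus by blast
    note \<delta>0 = ac_modulus_pos[OF \<delta>]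
    have N0: "N \<in> null_sets lebesgue" using N by (simp add: negligible_iff_null_sets)
    \<comment> \<open>Outer regularity: the null set \<open>N\<close> lies in an open set of measure
      below \<delta>. Removing \<open>N\<close> does not change that measure.\<close>
    obtain G where G: "open G" "N \<subseteq> G" "G - N \<in> lmeasurable" "emeasure lebesgue (G - N) < ennreal \<delta>"
      using sets_lebesgue_outer_open[OF null_setsD2[OF N0] \<delta>0] by blast
    have GN: "emeasure lebesgue G = emeasure lebesgue (G - N)"
      using emeasure_Diff_null_set[OF N0, of G] G(1) by simp
    have Gm: "G \<in> lmeasurable"
      using GN G by (auto intro!: fmeasurableI simp: less_top[symmetric])
    have mG: "measure lebesgue G < \<delta>"
      using GN G(4) Gm \<delta>0 by (metis emeasure_eq_measure2 ennreal_less_iff measure_nonneg)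
    have "\<exists>d>0. \<forall>y\<in>{a..b}. norm (y - t) < d \<longrightarrow> norm (f y - f t) \<le> e * norm (y - t)"
      if "t \<in> {a..b} - N" for t
      using f[OF that] e unfolding has_vector_derivative_def has_derivative_within_alt by force
    then obtain d where d: "\<And>t. t \<in> {a..b} - N \<Longrightarrow> d t > 0"
      "\<And>t y. t \<in> {a..b} - N \<Longrightarrow> y \<in> {a..b} \<Longrightarrow> norm (y - t) < d t \<Longrightarrow> norm (f y - f t) \<le> e * norm (y - t)"
      by metis
    \<comment> \<open>A cell tagged in \<open>N\<close> is forced into \<open>G\<close>; a cell
      tagged elsewhere in the interval is so short that the zero derivative controls the increments
      from the tag. The last case only makes the gauge total.\<close>
    define \<gamma> where "\<gamma> t = (if t \<in> N then G else if t \<in> {a..b} then ball t (d t) else ball t 1)" for t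
    have "gauge \<gamma>" unfolding gauge_def \<gamma>_def using G(1,2) d(1) by auto
    then obtain p where p: "p tagged_division_of {a..b}" "\<gamma> fine p"
      using fine_division_exists_real by blast
    have fin: "finite p" using p(1) by blast
    have box: "\<exists>c d. k = {c..d} \<and> c \<le> x \<and> x \<le> d \<and> a \<le> c \<and> d \<le> b" if "(x, k) \<in> p" for x k
      using tagged_division_ofD(2,3,4)[OF p(1) that] by fastforce
    define q where "q = {(x, k) \<in> p. x \<in> N}"
    have q: "q \<subseteq> p" "finite q" using fin by (auto simp: q_def intro: finite_subset)
    \<comment> \<open>The tag lies between the endpoints of its cell, so the two estimates from the
      tag add up to exactly the length of the cell.\<close>
    have good: "norm (f (Sup k) - f (Inf k)) \<le> e * measure lborel k" if "(x, k) \<in> p - q" for x k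
    proof -
      have "(x, k) \<in> p" using that by simp
      from box[OF this]
      obtain c1 c2 where k: "k = {c1..c2}" "c1 \<le> x" "x \<le> c2" "a \<le> c1" "c2 \<le> b" by blast
      have x: "x \<in> {a..b} - N" using that k by (auto simp: q_def)
      have "k \<subseteq> ball x (d x)"
        using fineD[OF p(2), of x k] that x by (auto simp: \<gamma>_def)
      moreover have "c1 \<in> k" "c2 \<in> k" using k by auto
      ultimately have "c1 \<in> ball x (d x)" "c2 \<in> ball x (d x)" by blast+
      then have near: "norm (c1 - x) < d x" "norm (c2 - x) < d x"
        by (simp_all add: dist_norm norm_minus_commute)
      have "norm (f c1 - f x) \<le> e * norm (c1 - x)" "norm (f c2 - f x) \<le> e * norm (c2 - x)"
        using d(2)[OF x _ near(1)] d(2)[OF x _ near(2)] k by auto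
      moreover have "norm (f c2 - f c1) \<le> norm (f c2 - f x) + norm (f c1 - f x)"
        by (metis norm_triangle_ineq4 diff_diff_eq2 diff_add_cancel)
      ultimately show ?thesis using k by (auto simp: algebra_simps)
    qed
    have bad: "(\<Sum>(x, k)\<in>q. norm (f (Sup k) - f (Inf k))) < e"
    proof -
      \<comment> \<open>Absolute continuity speaks of families indexed by natural numbers, hence the
        enumeration of the bad cells.\<close>
      obtain g where g: "bij_betw g {0..<card q} q"
        using ex_bij_betw_nat_finite[OF q(2)] by blast
      have re: "(\<Sum>i<card q. F (g i)) = sum F q" for F :: "real \<times> real set \<Rightarrow> real"
        using sum.reindex_bij_betw[OF g, of F] by (simp add: atLeast0LessThan)
      define u where "u i = Inf (snd (g i))" for i
      define v where "v i = Sup (snd (g i))" for i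
      have gq: "g i \<in> q" if "i < card q" for i using g that by (auto simp: bij_betw_def)
      have uv: "snd (g i) = {u i..v i} \<and> a \<le> u i \<and> u i \<le> v i \<and> v i \<le> b" if "i < card q" for i
      proof -
        have "(fst (g i), snd (g i)) \<in> p" using gq[OF that] q by auto
        from box[OF this] show ?thesis by (auto simp: u_def v_def)
      qed
      have "(\<Sum>i<card q. v i - u i) = (\<Sum>i<card q. measure lborel (snd (g i)))"
        using uv by (intro sum.cong) auto
      also have "\<dots> = (\<Sum>(x, k)\<in>q. measure lborel k)"
        using re[of "\<lambda>q. measure lborel (snd q)"] by (simp add: split_beta)
      also have "\<dots> \<le> measure lebesgue G"
      proof (rule sum_content_le_measure[OF _ q(2) _ Gm])
        show "q tagged_partial_division_of {a..b}"
          using p(1) q(1) tagged_partial_division_subset tagged_division_of_def by blast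
        show "k \<subseteq> G" if "(x, k) \<in> q" for x k
          using fineD[OF p(2), of x k] that by (auto simp: \<gamma>_def q_def)
      qed
      also note mG
      finally have small: "(\<Sum>i<card q. v i - u i) < \<delta>" .
      have "{u i<..<v i} \<inter> {u j<..<v j} = {}" if "i < card q" "j < card q" "i \<noteq> j" for i j
      proof -
        have "g i \<noteq> g j" using g that by (auto simp: bij_betw_def inj_on_def)
        moreover have "(fst (g i), snd (g i)) \<in> p" "(fst (g j), snd (g j)) \<in> p"
          using gq q that by auto
        ultimately have "interior (snd (g i)) \<inter> interior (snd (g j)) = {}"
          using tagged_division_ofD(5)[OF p(1)] by (metis prod.collapse)
        then show ?thesis using uv that by auto
      qed
      with ac_modulusD[OF \<delta>, of "card q" u v] uv small have "(\<Sum>i<card q. norm (f (v i) - f (u i))) < e" by blast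
      then show ?thesis
        using re[of "\<lambda>(x, k). norm (f (Sup k) - f (Inf k))"] by (simp add: u_def v_def split_beta)
    qed
    have "norm (f b - f a) = norm (\<Sum>(x, k)\<in>p. f (Sup k) - f (Inf k))"
      by (simp only: additive_tagged_division_1[OF \<open>a \<le> b\<close> p(1)])
    also have "\<dots> \<le> (\<Sum>(x, k)\<in>p. norm (f (Sup k) - f (Inf k)))"
      by (rule order_trans[OF norm_sum]) (simp add: split_beta)
    also have "\<dots> = (\<Sum>(x, k)\<in>q. norm (f (Sup k) - f (Inf k))) + (\<Sum>(x, k)\<in>p-q. norm (f (Sup k) - f (Inf k)))"
      using sum.subset_diff[OF q(1) fin] by (simp add: add.commute)
    also have "(\<Sum>(x, k)\<in>p-q. norm (f (Sup k) - f (Inf k))) \<le> (\<Sum>(x, k)\<in>p-q. e * measure lborel k)"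
      using good by (intro sum_mono) auto
    also have "\<dots> \<le> (\<Sum>(x, k)\<in>p. e * measure lborel k)"
      using fin e by (intro sum_mono2) auto
    also have "\<dots> = e * (b - a)"
      using additive_content_tagged_division[of p a b] p(1) \<open>a \<le> b\<close>
      by (simp add: sum_distrib_left[symmetric] split_beta)
    finally show ?thesis using bad by (simp add: algebra_simps)
  qed note est = this
  have "norm (f b - f a) \<le> 0 + e" if "e > 0" for e
    using est[of "e / (1 + (b - a))"] that \<open>a \<le> b\<close> by simp
  then have "norm (f b - f a) \<le> 0" by (rule field_le_epsilon)
  then show ?thesis by simp
qed

section \<open>From almost-everywhere solutions to classical solutions and back\<close>

lemma AE_lebesgue_on_Icc_negligible:
  assumes "AE t in lebesgue_on {a..b::real}. Q t"
  obtains N where "negligible N" "\<And>t. t \<in> {a..b} - N \<Longrightarrow> Q t"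
proof -
  have "AE t in lebesgue. t \<in> {a..b} \<longrightarrow> Q t"
    using assms by (simp add: AE_restrict_space_iff)
  then obtain N where "N \<in> null_sets lebesgue" "{t. \<not> (t \<in> {a..b} \<longrightarrow> Q t)} \<subseteq> N"
    by (auto simp: eventually_ae_filter)
  then show ?thesis using that[of N] by (auto simp: negligible_iff_null_sets)
qed

text \<open>The difference of \<open>x\<close> and an indefinite integral of \<open>g\<close> is
  absolutely continuous with derivative zero almost everywhere, hence constant; so \<open>x\<close>
  inherits the derivative of the integral at every point.\<close>

lemma ae_solution_continuous_rhs:
  fixes x :: "real \<Rightarrow> 'a::euclidean_space"
  assumes x: "ae_solution a b x g" and g: "continuous_on {a..b} g" and t: "t \<in> {a..b}"
  shows "(x has_vector_derivative g t) (at t within {a..b})"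
proof -
  define G where "G = (\<lambda>t. integral {a..t} g)"
  have G: "(G has_vector_derivative g t) (at t within {a..b})" if "t \<in> {a..b}" for t
    unfolding G_def by (rule integral_has_vector_derivative[OF g that])
  have ac: "absolutely_continuous_between a b (\<lambda>t. x t - G t)"
    using x absolutely_continuous_between_C1[OF G g]
    by (intro absolutely_continuous_between_diff) (auto simp: ae_solution_def)
  obtain N where N: "negligible N"
    "\<And>t. t \<in> {a..b} - N \<Longrightarrow> (x has_vector_derivative g t) (at t within {a..b})"
    using x AE_lebesgue_on_Icc_negligible unfolding ae_solution_def by blast
  have eq: "x a - G a + G s = x s" if s: "s \<in> {a..b}" for s
  proof -
    have "x s - G s = x a - G a"
    proof (rule absolutely_continuous_ae_zero_derivative_eq[OF _ _ N(1)])
      show "absolutely_continuous_between a s (\<lambda>t. x t - G t)"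
        using absolutely_continuous_between_subinterval[OF ac] s by auto
      show "((\<lambda>t. x t - G t) has_vector_derivative 0) (at r within {a..s})" if "r \<in> {a..s} - N" for r
        using has_vector_derivative_diff[OF N(2) G, of r] that s
        by (auto intro: has_vector_derivative_within_subset)
    qed (use s in auto)
    then show ?thesis by (simp add: algebra_simps)
  qed
  have "((\<lambda>s. x a - G a + G s) has_vector_derivative 0 + g t) (at t within {a..b})"
    by (intro derivative_intros G t)
  then show ?thesis
    using has_vector_derivative_transform[OF t, of x "\<lambda>s. x a - G a + G s" "g t"] eq by simp
qed

lemma ae_solution_C1:
  assumes "\<And>t. t \<in> {a..b} \<Longrightarrow> (x has_vector_derivative g t) (at t within {a..b})"
    and "continuous_on {a..b} g"
  shows "ae_solution a b x g"
  using assms absolutely_continuous_between_C1[of a b x g] by (auto simp: ae_solution_def)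

lemma ae_solution_diff:
  assumes "ae_solution a b x f" "ae_solution a b y g"
  shows "ae_solution a b (\<lambda>t. x t - y t) (\<lambda>t. f t - g t)"
  using assms by (auto simp: ae_solution_def absolutely_continuous_between_diff
      elim!: eventually_elim2 intro: has_vector_derivative_diff)

lemma ae_solution_add:
  assumes "ae_solution a b x f" "ae_solution a b y g"
  shows "ae_solution a b (\<lambda>t. x t + y t) (\<lambda>t. f t + g t)"
  using assms by (auto simp: ae_solution_def absolutely_continuous_between_add
      elim!: eventually_elim2 intro: has_vector_derivative_add)

section \<open>Global existence for Lipschitz right-hand sides\<close>

text \<open>Picard iteration; the weight \<open>exp (2 * K * (t - a))\<close> makes consecutive iterates contract by
  a factor of one half on the whole interval.\<close>

lemma picard_lindelof_global:
  fixes F :: "real \<Rightarrow> 'a::euclidean_space \<Rightarrow> 'a"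
  assumes "a \<le> b"
    and lip: "\<And>t x y. t \<in> {a..b} \<Longrightarrow> norm (F t x - F t y) \<le> K * norm (x - y)"
    and cont: "\<And>x. continuous_on {a..b} x \<Longrightarrow> continuous_on {a..b} (\<lambda>t. F t (x t))"
  shows "\<exists>x. x a = x0 \<and> (\<forall>t\<in>{a..b}. (x has_vector_derivative F t (x t)) (at t within {a..b}))"
proof -
  define L where "L = max K 1"
  have L: "L > 0" by (simp add: L_def)
  have lip: "norm (F t x - F t y) \<le> L * norm (x - y)" if "t \<in> {a..b}" for t x y
    using lip[OF that, of x y] mult_right_mono[of K L "norm (x - y)"] by (simp add: L_def)
  define X where "X n = ((\<lambda>x t. x0 + integral {a..t} (\<lambda>s. F s (x s))) ^^ n) (\<lambda>_. x0)" for n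
  have X0: "X 0 = (\<lambda>_. x0)" and XS: "X (Suc n) t = x0 + integral {a..t} (\<lambda>s. F s (X n s))" for n t
    by (simp_all add: X_def)
  have contX: "continuous_on {a..b} (X n)" for n
  proof (induction n)
    case (Suc n)
    then have "(\<lambda>s. F s (X n s)) integrable_on {a..b}"
      using integrable_continuous_real[OF cont] by blast
    then have "continuous_on {a..b} (\<lambda>t. x0 + integral {a..t} (\<lambda>s. F s (X n s)))"
      by (intro continuous_intros indefinite_integral_continuous_1)
    then show ?case by (simp add: XS[abs_def])
  qed (simp add: X0)
  have contF: "continuous_on {a..t} (\<lambda>s. F s (X n s))" if "t \<in> {a..b}" for n t
    using continuous_on_subset[OF cont[OF contX[of n]]] that by auto
  \<comment> \<open>The integral of \<open>w\<close> up to \<open>t\<close> is at most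
    \<open>w t / (2 * L)\<close>; the Lipschitz constant \<open>L\<close> then cancels and leaves
    the factor one half.\<close>
  define w where "w t = exp (2 * L * (t - a))" for t
  have w: "integral {a..t} w \<le> w t / (2 * L)" and wi: "w integrable_on {a..t}" if "t \<in> {a..b}" for t
  proof -
    have "(w has_integral w t / (2 * L) - w a / (2 * L)) {a..t}"
      using that L unfolding w_def
      by (intro fundamental_theorem_of_calculus)
         (auto intro!: derivative_eq_intros simp flip: has_real_derivative_iff_has_vector_derivative)
    then show "integral {a..t} w \<le> w t / (2 * L)" "w integrable_on {a..t}"
      using L by (auto simp: has_integral_iff w_def)
  qed
  obtain C where C: "\<And>t. t \<in> {a..b} \<Longrightarrow> norm (F t x0) \<le> C"
    using compact_imp_bounded[OF compact_continuous_image[OF cont[OF contX[of 0]] compact_Icc]]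
    unfolding bounded_iff by (fastforce simp: X0)
  \<comment> \<open>\<open>D\<close> bounds the first Picard step on the whole interval;
    \<open>max\<close> keeps it nonnegative, and \<open>w\<close> is at least 1 there.\<close>
  define D where "D = max C 0 * (b - a)"
  have D: "D \<ge> 0" using \<open>a \<le> b\<close> by (simp add: D_def)
  have step: "norm (X (Suc n) t - X n t) \<le> D * w t * (1/2)^n" if "t \<in> {a..b}" for n t
    using that
  proof (induction n arbitrary: t)
    case 0
    have "norm (integral {a..t} (\<lambda>s. F s x0)) \<le> max C 0 * (t - a)"
      using 0 C contF[OF 0, of 0] unfolding X0
      by (intro integral_bound) (auto simp: le_max_iff_disj)
    also have "\<dots> \<le> D" unfolding D_def using 0 by (intro mult_left_mono) auto
    also have "\<dots> \<le> D * w t" using D L 0 by (simp add: w_def mult_le_cancel_left1)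
    finally show ?case by (simp add: XS X0)
  next
    case (Suc n)
    have "X (Suc (Suc n)) t - X (Suc n) t = integral {a..t} (\<lambda>s. F s (X (Suc n) s) - F s (X n s))"
      using integral_diff[OF integrable_continuous_real[OF contF[OF Suc.prems, of "Suc n"]]
          integrable_continuous_real[OF contF[OF Suc.prems, of n]]]
      by (simp only: XS) simp
    also have "norm \<dots> \<le> integral {a..t} (\<lambda>s. L * (D * (1/2)^n) * w s)"
    proof (rule integral_norm_bound_integral)
      show "(\<lambda>s. F s (X (Suc n) s) - F s (X n s)) integrable_on {a..t}"
        by (intro integrable_continuous_real continuous_intros contF Suc.prems)
      show "(\<lambda>s. L * (D * (1/2)^n) * w s) integrable_on {a..t}"
        by (intro integrable_on_mult_right wi Suc.prems)
      show "norm (F s (X (Suc n) s) - F s (X n s)) \<le> L * (D * (1/2)^n) * w s" if "s \<in> {a..t}" for s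
        using order_trans[OF lip[of s "X (Suc n) s" "X n s"] mult_left_mono[OF Suc.IH[of s], of L]]
          that Suc.prems L by (auto simp: mult_ac)
    qed
    also have "\<dots> \<le> L * (D * (1/2)^n) * (w t / (2 * L))"
      using w[OF Suc.prems] L D by (simp only: integral_mult_right) (intro mult_left_mono, auto)
    also have "\<dots> = D * w t * (1/2)^Suc n" using L by simp
    finally show ?case .
  qed
  \<comment> \<open>The limit is written as a telescoping series of Picard steps, so that the
    Weierstrass test gives uniform convergence.\<close>
  define x where "x t = x0 + (\<Sum>n. X (Suc n) t - X n t)" for t
  have tele: "x0 + (\<Sum>i<n. X (Suc i) t - X i t) = X n t" for n t
    using sum_lessThan_telescope[of "\<lambda>i. X i t" n] by (simp add: X0)
  have series: "uniform_limit {a..b} (\<lambda>n t. \<Sum>i<n. X (Suc i) t - X i t) (\<lambda>t. \<Sum>n. X (Suc n) t - X n t) sequentially"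
  proof (rule Weierstrass_m_test)
    show "norm (X (Suc n) t - X n t) \<le> D * w b * (1/2)^n" if "t \<in> {a..b}" for n t
    proof -
      have "w t \<le> w b" using that L by (simp add: w_def)
      then have "D * w t * (1/2)^n \<le> D * w b * (1/2)^n" using D by (intro mult_right_mono mult_left_mono) auto
      with step[OF that] show ?thesis by (rule order_trans)
    qed
    show "summable (\<lambda>n. D * w b * (1/2)^n)" by (intro summable_mult summable_geometric) simp
  qed
  have "uniform_limit {a..b} (\<lambda>n t. x0 + (\<Sum>i<n. X (Suc i) t - X i t)) x sequentially"
    unfolding x_def[abs_def] by (intro uniform_limit_intros series)
  then have lim: "uniform_limit {a..b} X x sequentially"
    by (simp only: tele)
  have contx: "continuous_on {a..b} x"
    using uniform_limit_theorem[OF _ lim] contX by simp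
  have limF: "uniform_limit {a..b} (\<lambda>n s. F s (X n s)) (\<lambda>s. F s (x s)) sequentially"
  proof (rule uniform_limitI)
    fix e :: real assume "e > 0"
    then have "\<forall>\<^sub>F n in sequentially. \<forall>s\<in>{a..b}. dist (X n s) (x s) < e / L"
      using uniform_limitD[OF lim] L by simp
    then show "\<forall>\<^sub>F n in sequentially. \<forall>s\<in>{a..b}. dist (F s (X n s)) (F s (x s)) < e"
    proof eventually_elim
      case (elim n)
      then show ?case
        using lip L by (auto simp: dist_norm field_simps intro!: le_less_trans[OF lip])
    qed
  qed
  \<comment> \<open>Uniform convergence permits passing to the limit under the integral in the
    recursion \<open>XS\<close>.\<close>
  have fix_x: "x0 + integral {a..t} (\<lambda>s. F s (x s)) = x t" if t: "t \<in> {a..b}" for t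
  proof -
    have "uniform_limit {a..t} (\<lambda>n s. F s (X n s)) (\<lambda>s. F s (x s)) sequentially"
      using uniform_limit_on_subset[OF limF] t by auto
    then obtain I J where IJ: "\<And>n. ((\<lambda>s. F s (X n s)) has_integral I n) {a..t}"
        "((\<lambda>s. F s (x s)) has_integral J) {a..t}" "I \<longlonglongrightarrow> J"
      by (rule uniform_limit_integral) (use contF t in auto)
    then have "(\<lambda>n. integral {a..t} (\<lambda>s. F s (X n s))) \<longlonglongrightarrow> integral {a..t} (\<lambda>s. F s (x s))"
      by (simp add: has_integral_iff)
    then have "(\<lambda>n. X (Suc n) t) \<longlonglongrightarrow> x0 + integral {a..t} (\<lambda>s. F s (x s))"
      unfolding XS by (intro tendsto_intros)
    moreover have "(\<lambda>n. X (Suc n) t) \<longlonglongrightarrow> x t"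
      using tendsto_uniform_limitI[OF lim t] by (rule LIMSEQ_Suc)
    ultimately show ?thesis using LIMSEQ_unique by blast
  qed
  have "(x has_vector_derivative F t (x t)) (at t within {a..b})" if t: "t \<in> {a..b}" for t
  proof -
    have "((\<lambda>t. x0 + integral {a..t} (\<lambda>s. F s (x s))) has_vector_derivative 0 + F t (x t)) (at t within {a..b})"
      by (intro has_vector_derivative_add has_vector_derivative_const integral_has_vector_derivative cont contx t)
    then show ?thesis
      using has_vector_derivative_transform[OF t, of x "\<lambda>t. x0 + integral {a..t} (\<lambda>s. F s (x s))"] fix_x by simp
  qed
  moreover have "x a = x0" using fix_x[of a] \<open>a \<le> b\<close> by simp
  ultimately show ?thesis by blast
qed

text \<open>Reversing time by \<open>a + b - t\<close> exchanges the endpoints and changes the sign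
  of the right-hand side, which keeps its Lipschitz constant.\<close>

lemma picard_lindelof_global_terminal:
  fixes F :: "real \<Rightarrow> 'a::euclidean_space \<Rightarrow> 'a"
  assumes "a \<le> b"
    and lip: "\<And>t x y. t \<in> {a..b} \<Longrightarrow> norm (F t x - F t y) \<le> K * norm (x - y)"
    and cont: "\<And>x. continuous_on {a..b} x \<Longrightarrow> continuous_on {a..b} (\<lambda>t. F t (x t))"
  shows "\<exists>x. x b = x1 \<and> (\<forall>t\<in>{a..b}. (x has_vector_derivative F t (x t)) (at t within {a..b}))"
proof -
  let ?r = "\<lambda>t. a + b - t"
  have rI: "?r ` {a..b} = {a..b}"
    by (auto simp: image_iff intro!: bexI[of _ "?r _"])
  have cr: "continuous_on {a..b} (x \<circ> ?r)" if "continuous_on {a..b} x" for x :: "real \<Rightarrow> 'a"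
    using that by (intro continuous_on_compose continuous_intros) (simp add: rI)
  have "\<exists>y. y a = x1 \<and> (\<forall>t\<in>{a..b}. (y has_vector_derivative - F (?r t) (y t)) (at t within {a..b}))"
  proof (rule picard_lindelof_global[OF \<open>a \<le> b\<close>])
    show "norm (- F (?r t) x - - F (?r t) y) \<le> K * norm (x - y)" if "t \<in> {a..b}" for t x y
      using lip[of "?r t" x y] that by (simp add: norm_minus_commute)
    show "continuous_on {a..b} (\<lambda>t. - F (?r t) (x t))" if "continuous_on {a..b} x" for x
      using cr[OF cont[OF cr[OF that]]] by (intro continuous_intros) (simp add: o_def)
  qed
  then obtain y where y: "y a = x1"
    "\<And>t. t \<in> {a..b} \<Longrightarrow> (y has_vector_derivative - F (?r t) (y t)) (at t within {a..b})" by blast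
  have "((y \<circ> ?r) has_vector_derivative F t ((y \<circ> ?r) t)) (at t within {a..b})" if "t \<in> {a..b}" for t
  proof -
    have "(?r has_vector_derivative -1) (at t within {a..b})"
      by (auto intro!: derivative_eq_intros)
    moreover have "(y has_vector_derivative - F t (y (?r t))) (at (?r t) within ?r ` {a..b})"
      unfolding rI using y(2)[of "?r t"] that by simp
    ultimately show ?thesis using vector_diff_chain_within by fastforce
  qed
  then show ?thesis using y(1) by (intro exI[of _ "y \<circ> ?r"]) auto
qed

section \<open>Linear Hamiltonian systems\<close>

lemma bounded_bilinear_matrix_vector_mult:
  "bounded_bilinear (\<lambda>(M::real^'n^'m) x. M *v x)"
  by (subst bilinear_conv_bounded_bilinear[symmetric])
     (auto simp: bilinear_def linear_iff algebra_simps scaleR_matrix_vector_assoc)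

lemma bounded_bilinear_matrix_matrix_mult:
  "bounded_bilinear (\<lambda>(M::real^'n^'m) (N::real^'k^'n). M ** N)"
  by (subst bilinear_conv_bounded_bilinear[symmetric])
     (auto simp: bilinear_def linear_iff vec_eq_iff matrix_matrix_mult_def sum.distrib
       sum_distrib_left algebra_simps)

lemma bounded_linear_transpose: "bounded_linear (transpose :: real^'n^'m \<Rightarrow> real^'m^'n)"
  by (subst linear_conv_bounded_linear[symmetric])
     (auto simp: linear_iff transpose_def vec_eq_iff)

lemmas continuous_on_matrix_vector_mult = bounded_bilinear.continuous_on[OF bounded_bilinear_matrix_vector_mult]
lemmas continuous_on_matrix_matrix_mult = bounded_bilinear.continuous_on[OF bounded_bilinear_matrix_matrix_mult]
lemmas continuous_on_transpose = bounded_linear.continuous_on[OF bounded_linear_transpose]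

lemma uminus_matrix_vector_mult:
  fixes M :: "real^'n^'m"
  shows "(- M) *v x = - (M *v x)"
  by (simp add: vec_eq_iff matrix_vector_mult_def sum_negf)

lemma inner_transpose_mult:
  fixes M :: "real^'n^'m"
  shows "(transpose M *v x) \<bullet> y = x \<bullet> (M *v y)"
  by (simp add: dot_lmul_matrix)

text \<open>The columns of a matrix are its values at the axis vectors, so continuity of the action
  on each vector gives continuity of all entries.\<close>

lemma continuous_on_matrix:
  fixes M :: "'a::topological_space \<Rightarrow> real^'n^'m"
  assumes "\<And>x. continuous_on S (\<lambda>s. M s *v x)"
  shows "continuous_on S M"
proof -
  have "continuous_on S (\<lambda>s. \<chi> i j. (M s *v axis j 1) $ i)"
    by (intro continuous_on_vec_lambda continuous_on_component assms)
  then show ?thesis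
    by (simp add: matrix_vector_mult_basis column_def vec_lambda_eta)
qed

text \<open>By the product rule the pairing is constant. It serves to pair a solution of an equation
  with one of its adjoint equation.\<close>

lemma inner_eq_if_derivative_zero:
  fixes x y :: "real \<Rightarrow> 'a::real_inner"
  assumes x: "\<And>t. t \<in> {a..b} \<Longrightarrow> (x has_vector_derivative x' t) (at t within {a..b})"
    and y: "\<And>t. t \<in> {a..b} \<Longrightarrow> (y has_vector_derivative y' t) (at t within {a..b})"
    and z: "\<And>t. t \<in> {a..b} \<Longrightarrow> x t \<bullet> y' t + x' t \<bullet> y t = 0"
    and st: "s \<in> {a..b}" "t \<in> {a..b}"
  shows "x s \<bullet> y s = x t \<bullet> y t"
proof -
  have "((\<lambda>t. x t \<bullet> y t) has_vector_derivative 0) (at r within {a..b})" if "r \<in> {a..b}" for r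
    using bounded_bilinear.has_vector_derivative[OF bounded_bilinear_inner x[OF that] y[OF that]]
      z[OF that] by simp
  then obtain c where "\<And>r. r \<in> {a..b} \<Longrightarrow> x r \<bullet> y r = c"
    using has_vector_derivative_zero_constant[of "{a..b}" "\<lambda>t. x t \<bullet> y t"] by auto
  then show ?thesis using st by simp
qed

text \<open>For symmetric \<open>Q\<close> and \<open>R\<close> and zero forcing these are
  Hamilton's equations of \<open>z \<bullet> (A t *v p) + (z \<bullet> (R t *v z) - p \<bullet> (Q t
  *v p)) / 2\<close>. Both equations admit a forcing, and derivatives are meant at every point of
  the interval.\<close>

definition hamiltonian_solution ::
  "real \<Rightarrow> real \<Rightarrow> (real \<Rightarrow> real^'n^'n) \<Rightarrow> (real \<Rightarrow> real^'n^'n) \<Rightarrow> (real \<Rightarrow> real^'n^'n) \<Rightarrow>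
   (real \<Rightarrow> real^'n) \<Rightarrow> (real \<Rightarrow> real^'n) \<Rightarrow> (real \<Rightarrow> real^'n) \<Rightarrow> (real \<Rightarrow> real^'n) \<Rightarrow> bool" where
  "hamiltonian_solution a b A Q R f g z p \<longleftrightarrow> (\<forall>t\<in>{a..b}.
     (z has_vector_derivative - transpose (A t) *v z t + Q t *v p t + f t) (at t within {a..b}) \<and>
     (p has_vector_derivative A t *v p t + R t *v z t + g t) (at t within {a..b}))"

lemma bounded_matrix_action:
  fixes M :: "real \<Rightarrow> real^'n^'m"
  assumes "continuous_on {a..b} M"
  obtains K where "0 \<le> K" "\<And>t x. t \<in> {a..b} \<Longrightarrow> norm (M t *v x) \<le> K * norm x"
proof -
  obtain C where C: "0 \<le> C" "\<And>(N::real^'n^'m) x. norm (N *v x) \<le> norm N * norm x * C"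
    using bounded_bilinear.nonneg_bounded[OF bounded_bilinear_matrix_vector_mult] by blast
  obtain D where D: "\<And>t. t \<in> {a..b} \<Longrightarrow> norm (M t) \<le> D"
    using compact_imp_bounded[OF compact_continuous_image[OF assms compact_Icc]]
    unfolding bounded_iff by fastforce
  have "norm (M t *v x) \<le> (max D 0 * C) * norm x" if t: "t \<in> {a..b}" for t x
  proof -
    have "norm (M t *v x) \<le> norm (M t) * (norm x * C)" using C(2)[of "M t" x] by (simp add: mult_ac)
    also have "\<dots> \<le> max D 0 * (norm x * C)"
      using D[OF t] C(1) by (intro mult_right_mono) auto
    finally show ?thesis by (simp add: mult_ac)
  qed
  then show ?thesis using C(1) by (intro that[of "max D 0 * C"]) auto
qed

section \<open>Initial and terminal value problems for the forced system\<close>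

context
  fixes a b :: real and A Q R :: "real \<Rightarrow> real^'n^'n" and f g :: "real \<Rightarrow> real^'n"
  assumes ab: "a \<le> b"
    and A: "continuous_on {a..b} A" and Q: "continuous_on {a..b} Q" and R: "continuous_on {a..b} R"
    and f: "continuous_on {a..b} f" and g: "continuous_on {a..b} g"
begin

text \<open>Joining both unknowns into one vector of the product space gives the form to which
  Picard iteration applies.\<close>

definition hamiltonian_field :: "real \<Rightarrow> (real^'n) \<times> (real^'n) \<Rightarrow> (real^'n) \<times> (real^'n)" where
  "hamiltonian_field t x = (- transpose (A t) *v fst x + Q t *v snd x + f t,
     A t *v snd x + R t *v fst x + g t)"

text \<open>The field is affine in the state, so the forcing drops out of differences, and
  compactness of the interval bounds the coefficient matrices uniformly.\<close>

lemma hamiltonian_field_lipschitz: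
  obtains K where
    "\<And>t x y. t \<in> {a..b} \<Longrightarrow> norm (hamiltonian_field t x - hamiltonian_field t y) \<le> K * norm (x - y)"
proof -
  have A': "continuous_on {a..b} (\<lambda>t. - transpose (A t))"
    by (intro continuous_intros continuous_on_transpose A)
  obtain K1 where K1: "0 \<le> K1" "\<And>t x. t \<in> {a..b} \<Longrightarrow> norm (- transpose (A t) *v x) \<le> K1 * norm x"
    using bounded_matrix_action[OF A'] by blast
  obtain K2 where K2: "0 \<le> K2" "\<And>t x. t \<in> {a..b} \<Longrightarrow> norm (Q t *v x) \<le> K2 * norm x"
    using bounded_matrix_action[OF Q] by blast
  obtain K3 where K3: "0 \<le> K3" "\<And>t x. t \<in> {a..b} \<Longrightarrow> norm (A t *v x) \<le> K3 * norm x"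
    using bounded_matrix_action[OF A] by blast
  obtain K4 where K4: "0 \<le> K4" "\<And>t x. t \<in> {a..b} \<Longrightarrow> norm (R t *v x) \<le> K4 * norm x"
    using bounded_matrix_action[OF R] by blast
  have "norm (hamiltonian_field t x - hamiltonian_field t y) \<le> (K1 + K2 + K3 + K4) * norm (x - y)"
    if t: "t \<in> {a..b}" for t x y
  proof -
    define z where "z = fst (x - y)"
    define p where "p = snd (x - y)"
    have n: "norm z \<le> norm (x - y)" "norm p \<le> norm (x - y)"
      unfolding z_def p_def 
      using norm_fst_le[of "fst (x - y)" "snd (x - y)"] norm_snd_le[of "snd (x - y)" "fst (x - y)"]
      unfolding prod.collapse by auto
    have "hamiltonian_field t x - hamiltonian_field t y =
        (- transpose (A t) *v z + Q t *v p, A t *v p + R t *v z)"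
      unfolding hamiltonian_field_def z_def p_def fst_diff snd_diff matrix_vector_mult_diff_distrib
      by simp
    also have "norm \<dots> \<le> norm (- transpose (A t) *v z + Q t *v p) + norm (A t *v p + R t *v z)"
      by (rule norm_Pair_le)
    also have "\<dots> \<le> (norm (- transpose (A t) *v z) + norm (Q t *v p)) + (norm (A t *v p) + norm (R t *v z))"
      by (intro add_mono norm_triangle_ineq)
    also have "\<dots> \<le> (K1 * norm z + K2 * norm p) + (K3 * norm p + K4 * norm z)"
      by (intro add_mono K1 K2 K3 K4 t)
    also have "\<dots> \<le> (K1 * norm (x - y) + K2 * norm (x - y)) + (K3 * norm (x - y) + K4 * norm (x - y))"
      by (intro add_mono mult_left_mono K1 K2 K3 K4 n)
    finally show ?thesis by (simp add: algebra_simps)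
  qed
  then show ?thesis using that by blast
qed

lemma continuous_on_hamiltonian_field:
  assumes "continuous_on {a..b} x"
  shows "continuous_on {a..b} (\<lambda>t. hamiltonian_field t (x t))"
  unfolding hamiltonian_field_def
  by (intro continuous_intros continuous_on_matrix_vector_mult continuous_on_transpose A Q R f g assms)

lemma hamiltonian_solution_of_field:
  assumes "\<forall>t\<in>{a..b}. (x has_vector_derivative hamiltonian_field t (x t)) (at t within {a..b})"
  shows "hamiltonian_solution a b A Q R f g (\<lambda>t. fst (x t)) (\<lambda>t. snd (x t))"
  unfolding hamiltonian_solution_def
proof (intro ballI conjI)
  fix t assume "t \<in> {a..b}"
  then have x: "(x has_vector_derivative hamiltonian_field t (x t)) (at t within {a..b})"
    using assms by blast
  show "((\<lambda>t. fst (x t)) has_vector_derivative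
      - transpose (A t) *v fst (x t) + Q t *v snd (x t) + f t) (at t within {a..b})"
    using bounded_linear.has_vector_derivative[OF bounded_linear_fst x]
    by (simp add: hamiltonian_field_def)
  show "((\<lambda>t. snd (x t)) has_vector_derivative
      A t *v snd (x t) + R t *v fst (x t) + g t) (at t within {a..b})"
    using bounded_linear.has_vector_derivative[OF bounded_linear_snd x]
    by (simp add: hamiltonian_field_def)
qed

lemma hamiltonian_solution_initial:
  obtains z p where "hamiltonian_solution a b A Q R f g z p" "z a = z0" "p a = p0"
proof -
  obtain K where K: "\<And>t x y. t \<in> {a..b} \<Longrightarrow>
      norm (hamiltonian_field t x - hamiltonian_field t y) \<le> K * norm (x - y)"
    using hamiltonian_field_lipschitz by blast
  obtain x where x: "x a = (z0, p0)"
    "\<forall>t\<in>{a..b}. (x has_vector_derivative hamiltonian_field t (x t)) (at t within {a..b})"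
    using picard_lindelof_global[OF ab K continuous_on_hamiltonian_field, of "(z0, p0)"] by auto
  then show ?thesis
    by (intro that[OF hamiltonian_solution_of_field[OF x(2)]]) simp_all
qed

text \<open>The Fredholm argument and the study of \<open>\<Phi> b s\<close> in its second argument
  both prescribe values at the right endpoint.\<close>

lemma hamiltonian_solution_terminal:
  obtains z p where "hamiltonian_solution a b A Q R f g z p" "z b = z1" "p b = p1"
proof -
  obtain K where K: "\<And>t x y. t \<in> {a..b} \<Longrightarrow>
      norm (hamiltonian_field t x - hamiltonian_field t y) \<le> K * norm (x - y)"
    using hamiltonian_field_lipschitz by blast
  obtain x where x: "x b = (z1, p1)"
    "\<forall>t\<in>{a..b}. (x has_vector_derivative hamiltonian_field t (x t)) (at t within {a..b})"
    using picard_lindelof_global_terminal[OF ab K continuous_on_hamiltonian_field, of "(z1, p1)"] by auto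
  then show ?thesis
    by (intro that[OF hamiltonian_solution_of_field[OF x(2)]]) simp_all
qed

end

section \<open>Superposition, Lagrange's identity and the Fredholm alternative\<close>

lemma hamiltonian_solution_add:
  assumes "hamiltonian_solution a b A Q R f g z p" "hamiltonian_solution a b A Q R f' g' z' p'"
  shows "hamiltonian_solution a b A Q R (\<lambda>t. f t + f' t) (\<lambda>t. g t + g' t)
    (\<lambda>t. z t + z' t) (\<lambda>t. p t + p' t)"
  unfolding hamiltonian_solution_def
proof (intro ballI conjI)
  fix t assume t: "t \<in> {a..b}"
  have "((\<lambda>t. z t + z' t) has_vector_derivative
      (- transpose (A t) *v z t + Q t *v p t + f t) + (- transpose (A t) *v z' t + Q t *v p' t + f' t))
      (at t within {a..b})"
    using assms t unfolding hamiltonian_solution_def by (intro has_vector_derivative_add) auto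
  then show "((\<lambda>t. z t + z' t) has_vector_derivative
      - transpose (A t) *v (z t + z' t) + Q t *v (p t + p' t) + (f t + f' t)) (at t within {a..b})"
    by (simp only: matrix_vector_right_distrib add_ac)
  have "((\<lambda>t. p t + p' t) has_vector_derivative
      (A t *v p t + R t *v z t + g t) + (A t *v p' t + R t *v z' t + g' t)) (at t within {a..b})"
    using assms t unfolding hamiltonian_solution_def by (intro has_vector_derivative_add) auto
  then show "((\<lambda>t. p t + p' t) has_vector_derivative
      A t *v (p t + p' t) + R t *v (z t + z' t) + (g t + g' t)) (at t within {a..b})"
    by (simp only: matrix_vector_right_distrib add_ac)
qed

lemma hamiltonian_solution_scaleR:
  assumes "hamiltonian_solution a b A Q R (\<lambda>_. 0) (\<lambda>_. 0) z p"
  shows "hamiltonian_solution a b A Q R (\<lambda>_. 0) (\<lambda>_. 0) (\<lambda>t. c *\<^sub>R z t) (\<lambda>t. c *\<^sub>R p t)"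
  unfolding hamiltonian_solution_def
proof (intro ballI conjI)
  fix t assume t: "t \<in> {a..b}"
  have "((\<lambda>t. c *\<^sub>R z t) has_vector_derivative
      c *\<^sub>R (- transpose (A t) *v z t + Q t *v p t + 0)) (at t within {a..b})"
    using assms t unfolding hamiltonian_solution_def
    by (intro bounded_linear.has_vector_derivative[OF bounded_linear_scaleR_right]) auto
  then show "((\<lambda>t. c *\<^sub>R z t) has_vector_derivative
      - transpose (A t) *v (c *\<^sub>R z t) + Q t *v (c *\<^sub>R p t) + 0) (at t within {a..b})"
    by (simp only: matrix_vector_mult_scaleR scaleR_add_right scaleR_zero_right)
  have "((\<lambda>t. c *\<^sub>R p t) has_vector_derivative
      c *\<^sub>R (A t *v p t + R t *v z t + 0)) (at t within {a..b})"
    using assms t unfolding hamiltonian_solution_def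
    by (intro bounded_linear.has_vector_derivative[OF bounded_linear_scaleR_right]) auto
  then show "((\<lambda>t. c *\<^sub>R p t) has_vector_derivative
      A t *v (c *\<^sub>R p t) + R t *v (c *\<^sub>R z t) + 0) (at t within {a..b})"
    by (simp only: matrix_vector_mult_scaleR scaleR_add_right scaleR_zero_right)
qed

text \<open>Lagrange's identity for the symplectic form: Hamiltonian systems are formally self-adjoint.\<close>

lemma hamiltonian_lagrange_identity:
  assumes Q: "\<And>t. t \<in> {a..b} \<Longrightarrow> transpose (Q t) = Q t" and R: "\<And>t. t \<in> {a..b} \<Longrightarrow> transpose (R t) = R t"
    and x: "hamiltonian_solution a b A Q R f g z p"
    and y: "hamiltonian_solution a b A Q R (\<lambda>_. 0) (\<lambda>_. 0) \<zeta> \<pi>"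
    and ab: "a \<le> b"
  shows "((\<lambda>t. f t \<bullet> \<pi> t - g t \<bullet> \<zeta> t) has_integral
    (z b \<bullet> \<pi> b - p b \<bullet> \<zeta> b) - (z a \<bullet> \<pi> a - p a \<bullet> \<zeta> a)) {a..b}"
proof (rule fundamental_theorem_of_calculus[OF ab])
  fix t assume t: "t \<in> {a..b}"
  let ?z' = "- transpose (A t) *v z t + Q t *v p t + f t" and ?p' = "A t *v p t + R t *v z t + g t"
  let ?\<zeta>' = "- transpose (A t) *v \<zeta> t + Q t *v \<pi> t + 0" and ?\<pi>' = "A t *v \<pi> t + R t *v \<zeta> t + 0"
  have "((\<lambda>t. z t \<bullet> \<pi> t - p t \<bullet> \<zeta> t) has_vector_derivative
      (z t \<bullet> ?\<pi>' + ?z' \<bullet> \<pi> t) - (p t \<bullet> ?\<zeta>' + ?p' \<bullet> \<zeta> t)) (at t within {a..b})"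
    using x y t unfolding hamiltonian_solution_def
    by (intro has_vector_derivative_diff bounded_bilinear.has_vector_derivative[OF bounded_bilinear_inner]) auto
  \<comment> \<open>The terms with \<open>A t\<close> cancel in adjoint pairs, those with
    \<open>Q t\<close> and \<open>R t\<close> by symmetry; only the forcing survives.\<close>
  moreover have "(- transpose (A t) *v u) \<bullet> w = - (u \<bullet> (A t *v w))" for u w
    by (simp add: uminus_matrix_vector_mult inner_transpose_mult del: transpose_matrix_vector)
  moreover have "(Q t *v u) \<bullet> w = u \<bullet> (Q t *v w)" "(R t *v u) \<bullet> w = u \<bullet> (R t *v w)" for u w
    using inner_transpose_mult[of "Q t" u w] inner_transpose_mult[of "R t" u w] Q[OF t] R[OF t] by auto
  ultimately show "((\<lambda>t. z t \<bullet> \<pi> t - p t \<bullet> \<zeta> t) has_vector_derivative f t \<bullet> \<pi> t - g t \<bullet> \<zeta> t) (at t within {a..b})"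
    by (simp add: inner_add_left inner_add_right inner_commute algebra_simps)
qed

text \<open>The Fredholm alternative. A vector orthogonal to all jumps of homogeneous solutions has the form
  \<open>(\<pi> b, - \<zeta> b)\<close> for a homogeneous solution \<open>(\<zeta>, \<pi>)\<close>; preservation of the symplectic form forces that
  solution to be periodic.\<close>

lemma hamiltonian_jump_solvable:
  fixes A Q R :: "real \<Rightarrow> real^'n^'n"
  assumes ab: "a \<le> b"
    and A: "continuous_on {a..b} A" and Q: "continuous_on {a..b} Q" and R: "continuous_on {a..b} R"
    and f: "continuous_on {a..b} f" and g: "continuous_on {a..b} g"
    and Qs: "\<And>t. t \<in> {a..b} \<Longrightarrow> transpose (Q t) = Q t" and Rs: "\<And>t. t \<in> {a..b} \<Longrightarrow> transpose (R t) = R t"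
    and compat: "\<And>\<zeta> \<pi>. hamiltonian_solution a b A Q R (\<lambda>_. 0) (\<lambda>_. 0) \<zeta> \<pi> \<Longrightarrow> \<zeta> a = \<zeta> b \<Longrightarrow> \<pi> a = \<pi> b \<Longrightarrow>
      ((\<lambda>t. f t \<bullet> \<pi> t - g t \<bullet> \<zeta> t) has_integral c \<bullet> \<pi> b - d \<bullet> \<zeta> b) {a..b}"
  obtains z p where "hamiltonian_solution a b A Q R f g z p" "z b - z a = c" "p b - p a = d"
proof -
  let ?hom = "hamiltonian_solution a b A Q R (\<lambda>_. 0) (\<lambda>_. 0)"
  define V where "V = {(z b - z a, p b - p a) | z p. ?hom z p}"
  have V: "subspace V"
  proof (rule subspaceI)
    have "?hom (\<lambda>_. 0) (\<lambda>_. 0)" by (simp add: hamiltonian_solution_def)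
    then show "0 \<in> V" unfolding V_def by (force simp: zero_prod_def)
    show "x + y \<in> V" if x: "x \<in> V" and y: "y \<in> V" for x y
    proof -
      obtain z p z' p' where zp: "x = (z b - z a, p b - p a)" "?hom z p"
          "y = (z' b - z' a, p' b - p' a)" "?hom z' p'"
        using x y unfolding V_def by blast
      have "?hom (\<lambda>t. z t + z' t) (\<lambda>t. p t + p' t)"
        using hamiltonian_solution_add[OF zp(2,4)] by simp
      moreover have "x + y = (z b + z' b - (z a + z' a), p b + p' b - (p a + p' a))"
        by (simp add: zp)
      ultimately show ?thesis unfolding V_def by (intro CollectI exI conjI)
    qed
    show "k *\<^sub>R x \<in> V" if x: "x \<in> V" for k x
    proof -
      obtain z p where zp: "x = (z b - z a, p b - p a)" "?hom z p"
        using x unfolding V_def by blast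
      have "k *\<^sub>R x = (k *\<^sub>R z b - k *\<^sub>R z a, k *\<^sub>R p b - k *\<^sub>R p a)"
        by (simp add: zp scaleR_diff_right)
      then show ?thesis 
        unfolding V_def using hamiltonian_solution_scaleR[OF zp(2), of k]
        by (intro CollectI exI[of _ "\<lambda>t. k *\<^sub>R z t"] exI[of _ "\<lambda>t. k *\<^sub>R p t"] conjI)
    qed
  qed
  \<comment> \<open>A particular solution starting at zero has its terminal value as jump; what is
    still missing must be the jump of a homogeneous solution.\<close>
  obtain z0 p0 where zp0: "hamiltonian_solution a b A Q R f g z0 p0" "z0 a = 0" "p0 a = 0"
    using hamiltonian_solution_initial[OF ab A Q R f g] by blast
  \<comment> \<open>In finite dimension a subspace equals its double orthogonal complement, so it is
    enough to test against vectors orthogonal to \<open>V\<close>.\<close>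
  have "(c - z0 b, d - p0 b) \<in> V\<^sup>\<bottom>\<^sup>\<bottom>"
    unfolding orthogonal_comp_def[of "V\<^sup>\<bottom>"]
  proof (intro CollectI ballI)
    fix u assume u: "u \<in> V\<^sup>\<bottom>"
    obtain \<alpha> \<beta> where \<alpha>\<beta>: "u = (\<alpha>, \<beta>)" by (cases u)
    \<comment> \<open>With this sign, orthogonality to \<open>u\<close> becomes vanishing of the
      symplectic form between a jump and the value of \<open>(\<zeta>, \<pi>)\<close> at
      \<open>b\<close>.\<close>
    obtain \<zeta> \<pi> where hom: "?hom \<zeta> \<pi>" and final: "\<zeta> b = - \<beta>" "\<pi> b = \<alpha>"
      using hamiltonian_solution_terminal[OF ab A Q R continuous_on_const continuous_on_const] by blast
    have orth: "(z b - z a) \<bullet> \<pi> b - (p b - p a) \<bullet> \<zeta> b = 0" if "?hom z p" for z p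
    proof -
      have "(z b - z a, p b - p a) \<in> V" using that unfolding V_def by blast
      then have "orthogonal (z b - z a, p b - p a) u" using u unfolding orthogonal_comp_def by blast
      then show ?thesis by (simp add: orthogonal_def \<alpha>\<beta> final)
    qed
    \<comment> \<open>These initial values are chosen so that preservation of the form, combined
      with \<open>orth\<close>, yields a sum of two squares equal to zero.\<close>
    obtain z p where zp: "?hom z p" "z a = \<pi> a - \<pi> b" "p a = \<zeta> b - \<zeta> a"
      using hamiltonian_solution_initial[OF ab A Q R continuous_on_const continuous_on_const] by blast
    have "((\<lambda>t. 0) has_integral (z b \<bullet> \<pi> b - p b \<bullet> \<zeta> b) - (z a \<bullet> \<pi> a - p a \<bullet> \<zeta> a)) {a..b}"
      using hamiltonian_lagrange_identity[OF Qs Rs zp(1) hom ab] by simp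
    then have "(z b \<bullet> \<pi> b - p b \<bullet> \<zeta> b) - (z a \<bullet> \<pi> a - p a \<bullet> \<zeta> a) = 0"
      using has_integral_unique has_integral_0 by blast
    then have "z a \<bullet> (\<pi> a - \<pi> b) + p a \<bullet> (\<zeta> b - \<zeta> a) = 0"
      using orth[OF zp(1)] by (simp add: inner_diff_left inner_diff_right)
    then have "(\<pi> a - \<pi> b) \<bullet> (\<pi> a - \<pi> b) = 0 \<and> (\<zeta> b - \<zeta> a) \<bullet> (\<zeta> b - \<zeta> a) = 0"
      unfolding zp(2,3) by (simp only: add_nonneg_eq_0_iff inner_ge_zero)
    then have per: "\<zeta> a = \<zeta> b" "\<pi> a = \<pi> b" by auto
    \<comment> \<open>The particular solution contributes nothing at \<open>a\<close>, so the same
      integral is computed here and in \<open>compat\<close>; equating the values gives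
      orthogonality.\<close>
    have "((\<lambda>t. f t \<bullet> \<pi> t - g t \<bullet> \<zeta> t) has_integral z0 b \<bullet> \<pi> b - p0 b \<bullet> \<zeta> b) {a..b}"
      using hamiltonian_lagrange_identity[OF Qs Rs zp0(1) hom ab] by (simp add: zp0)
    with compat[OF hom per] have "c \<bullet> \<pi> b - d \<bullet> \<zeta> b = z0 b \<bullet> \<pi> b - p0 b \<bullet> \<zeta> b"
      using has_integral_unique by blast
    then show "orthogonal u (c - z0 b, d - p0 b)"
      by (simp add: orthogonal_def \<alpha>\<beta> final inner_diff_right inner_commute)
  qed
  then have "(c - z0 b, d - p0 b) \<in> V" by (simp add: orthogonal_comp_self[OF V])
  then obtain z1 p1 where zp1: "?hom z1 p1" "c - z0 b = z1 b - z1 a" "d - p0 b = p1 b - p1 a"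
    unfolding V_def by auto
  have "hamiltonian_solution a b A Q R f g (\<lambda>t. z0 t + z1 t) (\<lambda>t. p0 t + p1 t)"
    using hamiltonian_solution_add[OF zp0(1) zp1(1)] by simp
  then show ?thesis
    using zp1(2,3) zp0(2,3) by (intro that) (auto simp: algebra_simps)
qed

text \<open>As \<open>Q\<close> and \<open>R\<close> are Gram matrices here, the derivative of
  \<open>\<zeta> \<bullet> \<pi>\<close> is a sum of squares. Periodicity makes its integral vanish,
  and continuity makes each square vanish pointwise.\<close>

lemma hamiltonian_periodic_degenerate:
  fixes A :: "real \<Rightarrow> real^'n^'n" and B :: "real \<Rightarrow> real^'r^'n" and H :: "real \<Rightarrow> real^'n^'m"
  assumes ab: "a < b" and B: "continuous_on {a..b} B" and H: "continuous_on {a..b} H"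
    and hom: "hamiltonian_solution a b A (\<lambda>t. transpose (H t) ** H t) (\<lambda>t. B t ** transpose (B t))
      (\<lambda>_. 0) (\<lambda>_. 0) \<zeta> \<pi>"
    and per: "\<zeta> a = \<zeta> b" "\<pi> a = \<pi> b" and t: "t \<in> {a..b}"
  shows "H t *v \<pi> t = 0" "transpose (B t) *v \<zeta> t = 0"
proof -
  let ?e = "\<lambda>t. (H t *v \<pi> t) \<bullet> (H t *v \<pi> t) + (transpose (B t) *v \<zeta> t) \<bullet> (transpose (B t) *v \<zeta> t)"
  have c: "continuous_on {a..b} \<zeta>" "continuous_on {a..b} \<pi>"
    using hom unfolding hamiltonian_solution_def
    by (auto simp: continuous_on_eq_continuous_within intro: has_vector_derivative_continuous)
  have cont: "continuous_on {a..b} ?e"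
    by (intro continuous_on_add continuous_on_inner continuous_on_matrix_vector_mult continuous_on_transpose c B H)
  have "(?e has_integral \<zeta> b \<bullet> \<pi> b - \<zeta> a \<bullet> \<pi> a) {a..b}"
  proof (rule fundamental_theorem_of_calculus)
    fix t assume t: "t \<in> {a..b}"
    have "((\<lambda>t. \<zeta> t \<bullet> \<pi> t) has_vector_derivative
        \<zeta> t \<bullet> (A t *v \<pi> t + (B t ** transpose (B t)) *v \<zeta> t + 0) +
        (- transpose (A t) *v \<zeta> t + (transpose (H t) ** H t) *v \<pi> t + 0) \<bullet> \<pi> t) (at t within {a..b})"
      using hom t unfolding hamiltonian_solution_def
      by (intro bounded_bilinear.has_vector_derivative[OF bounded_bilinear_inner]) auto
    moreover have "(- transpose (A t) *v \<zeta> t) \<bullet> \<pi> t = - (\<zeta> t \<bullet> (A t *v \<pi> t))"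
      by (simp add: uminus_matrix_vector_mult inner_transpose_mult del: transpose_matrix_vector)
    moreover have "((transpose (H t) ** H t) *v \<pi> t) \<bullet> \<pi> t = (H t *v \<pi> t) \<bullet> (H t *v \<pi> t)"
      by (simp only: matrix_vector_mul_assoc[symmetric] inner_transpose_mult)
    moreover have "\<zeta> t \<bullet> ((B t ** transpose (B t)) *v \<zeta> t) = (transpose (B t) *v \<zeta> t) \<bullet> (transpose (B t) *v \<zeta> t)"
      by (simp only: matrix_vector_mul_assoc[symmetric] inner_transpose_mult)
    ultimately show "((\<lambda>t. \<zeta> t \<bullet> \<pi> t) has_vector_derivative ?e t) (at t within {a..b})"
      by (simp add: inner_add_left inner_add_right add.commute del: transpose_matrix_vector)
  qed (use ab in simp)
  then have "integral {a..b} ?e = 0" using per by (simp add: integral_unique)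
  then have "\<forall>t\<in>{a..b}. ?e t = 0"
    using integral_eq_0_iff[OF cont ab] by simp
  then have "?e t = 0" using t by blast
  then have "(H t *v \<pi> t) \<bullet> (H t *v \<pi> t) = 0 \<and> (transpose (B t) *v \<zeta> t) \<bullet> (transpose (B t) *v \<zeta> t) = 0"
    by (simp only: add_nonneg_eq_0_iff inner_ge_zero)
  then show "H t *v \<pi> t = 0" "transpose (B t) *v \<zeta> t = 0" by (auto simp del: transpose_matrix_vector)
qed

section \<open>Fundamental matrices and the Gramian\<close>

text \<open>For each vector \<open>x\<close>, \<open>\<Phi> t s *v x\<close> solves the equation
  adjoint to that of \<pi>, so their pairing has the same value at \<open>t = s\<close> and
  \<open>t = b\<close>.\<close>

lemma fundamental_matrix_transpose_solution:
  assumes \<Phi>: "fundamental_matrix a b (\<lambda>t. - transpose (A t)) \<Phi>"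
    and \<pi>: "\<And>t. t \<in> {a..b} \<Longrightarrow> (\<pi> has_vector_derivative A t *v \<pi> t) (at t within {a..b})"
    and s: "s \<in> {a..b}"
  shows "transpose (\<Phi> b s) *v \<pi> b = \<pi> s"
proof -
  have "x \<bullet> (transpose (\<Phi> b s) *v \<pi> b) = x \<bullet> \<pi> s" for x
  proof -
    have "(\<Phi> b s *v x) \<bullet> \<pi> b = (\<Phi> s s *v x) \<bullet> \<pi> s"
    proof (rule inner_eq_if_derivative_zero[OF _ \<pi>])
      fix t assume t: "t \<in> {a..b}"
      have "((\<lambda>t. \<Phi> t s) has_vector_derivative - transpose (A t) ** \<Phi> t s) (at t within {a..b})"
        using \<Phi> s t unfolding fundamental_matrix_def by blast
      from bounded_bilinear.has_vector_derivative[OF bounded_bilinear_matrix_vector_mult this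
          has_vector_derivative_const[of x]]
      show "((\<lambda>t. \<Phi> t s *v x) has_vector_derivative (- transpose (A t) ** \<Phi> t s) *v x) (at t within {a..b})"
        by simp
      show "(\<Phi> t s *v x) \<bullet> (A t *v \<pi> t) + ((- transpose (A t) ** \<Phi> t s) *v x) \<bullet> \<pi> t = 0"
        by (simp add: matrix_vector_mul_assoc[symmetric] uminus_matrix_vector_mult inner_transpose_mult
            del: transpose_matrix_vector)
    qed (use s in auto)
    moreover have "\<Phi> s s = mat 1" using \<Phi> s unfolding fundamental_matrix_def by blast
    ultimately show ?thesis
      using inner_transpose_mult[of "\<Phi> b s" "\<pi> b" x] by (simp add: inner_commute del: transpose_matrix_vector)
  qed
  then show ?thesis using vector_eq_ldot by blast
qed

text \<open>The definition of \<Phi> prescribes derivatives in the first argument only. The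
  behaviour in the second is recovered by identifying the transposed matrix with the solution of a
  terminal value problem.\<close>

lemma fundamental_matrix_adjoint:
  assumes \<Phi>: "fundamental_matrix a b (\<lambda>t. - transpose (A t)) \<Phi>"
    and A: "continuous_on {a..b} A" and s: "s \<in> {a..b}"
  shows "((\<lambda>s. transpose (\<Phi> b s) *v q) has_vector_derivative A s *v (transpose (\<Phi> b s) *v q))
    (at s within {a..b})"
proof -
  \<comment> \<open>With \<open>Q\<close> and \<open>R\<close> zero the system decouples, and its
    second component solves the plain linear equation.\<close>
  obtain z \<pi> where "hamiltonian_solution a b A (\<lambda>_. 0) (\<lambda>_. 0) (\<lambda>_. 0) (\<lambda>_. 0) z \<pi>" and q: "\<pi> b = q"
    using hamiltonian_solution_terminal[OF _ A continuous_on_const continuous_on_const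
        continuous_on_const continuous_on_const] s by (metis atLeastAtMost_iff order_trans)
  then have \<pi>: "\<And>t. t \<in> {a..b} \<Longrightarrow> (\<pi> has_vector_derivative A t *v \<pi> t) (at t within {a..b})"
    by (simp add: hamiltonian_solution_def)
  have eq: "transpose (\<Phi> b t) *v q = \<pi> t" if "t \<in> {a..b}" for t
    using fundamental_matrix_transpose_solution[OF \<Phi> \<pi> that] by (simp only: q)
  show ?thesis
    unfolding eq[OF s]
    by (rule has_vector_derivative_transform[OF s _ \<pi>[OF s]]) (rule eq)
qed

lemma continuous_on_fundamental_matrix_snd:
  assumes \<Phi>: "fundamental_matrix a b (\<lambda>t. - transpose (A t)) \<Phi>"
    and A: "continuous_on {a..b} A"
  shows "continuous_on {a..b} (\<lambda>s. \<Phi> b s)"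
proof -
  have "continuous_on {a..b} (\<lambda>s. transpose (\<Phi> b s))"
  proof (rule continuous_on_matrix)
    show "continuous_on {a..b} (\<lambda>s. transpose (\<Phi> b s) *v q)" for q
      unfolding continuous_on_eq_continuous_within
      using fundamental_matrix_adjoint[OF \<Phi> A] has_vector_derivative_continuous by blast
  qed
  from continuous_on_transpose[OF this] show ?thesis by simp
qed

text \<open>\<open>M ** pseudoinverse M\<close> is the orthogonal projection onto the range of
  \<open>M\<close>, so \<open>P\<close> projects onto the null space of \<open>transpose M\<close>.
  For \<open>M = mat 1 - \<Phi> \<omega> 0\<close> these are the endpoint values of periodic
  solutions of \<open>\<pi>' = A \<pi>\<close>.\<close>

lemma transpose_pseudoinverse_complement:
  fixes M :: "real^'n^'m"
  defines "P \<equiv> mat 1 - M ** pseudoinverse M"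
  shows "transpose P = P" "transpose M *v (P *v v) = 0"
    "transpose M *v q = 0 \<Longrightarrow> P *v q = q"
proof -
  have pinv: "M ** pseudoinverse M ** M = M" "transpose (M ** pseudoinverse M) = M ** pseudoinverse M"
    using is_pseudoinverse_pseudoinverse[of M] unfolding is_pseudoinverse_def by auto
  have diff: "transpose (X - Y) = transpose X - transpose Y" for X Y :: "real^'m^'m"
    by (simp add: vec_eq_iff transpose_def)
  show P: "transpose P = P" by (simp only: P_def diff transpose_mat pinv)
  have "x \<bullet> (transpose M *v (P *v v)) = x \<bullet> 0" for x
  proof -
    have "P *v (M *v x) = M *v x - (M ** pseudoinverse M ** M) *v x"
      unfolding P_def by (simp add: matrix_vector_mult_diff_rdistrib matrix_vector_mul_assoc[symmetric])
    then have "P *v (M *v x) = 0" by (simp add: pinv)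
    have "x \<bullet> (transpose M *v (P *v v)) = (transpose P *v v) \<bullet> (M *v x)"
      by (metis inner_commute inner_transpose_mult P)
    also have "\<dots> = v \<bullet> (P *v (M *v x))" by (rule inner_transpose_mult)
    finally show ?thesis using \<open>P *v (M *v x) = 0\<close> by simp
  qed
  then show "transpose M *v (P *v v) = 0" using vector_eq_ldot by blast
  assume q: "transpose M *v q = 0"
  have "(M ** pseudoinverse M) *v q = transpose (M ** pseudoinverse M) *v q" by (simp only: pinv)
  also have "\<dots> = transpose (pseudoinverse M) *v (transpose M *v q)"
    by (simp only: matrix_transpose_mul matrix_vector_mul_assoc)
  also have "\<dots> = 0" by (simp only: q matrix_vector_mult_0_right)
  finally show "P *v q = q" by (simp add: P_def matrix_vector_mult_diff_rdistrib)
qed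

text \<open>The quadratic form of the Gramian at \<open>v\<close> is the integral of the squared
  norm of \<open>G s *v v\<close>; if it is zero, the continuous integrand vanishes
  everywhere.\<close>

lemma null_space_gram_integral:
  fixes G :: "real \<Rightarrow> real^'n^'m"
  assumes ab: "a < b" and G: "continuous_on {a..b} G"
  shows "v \<in> null_space (integral {a..b} (\<lambda>s. transpose (G s) ** G s)) \<longleftrightarrow> (\<forall>s\<in>{a..b}. G s *v v = 0)"
proof -
  define W where "W = integral {a..b} (\<lambda>s. transpose (G s) ** G s)"
  have int: "(\<lambda>s. transpose (G s) ** G s) integrable_on {a..b}"
    by (intro integrable_continuous_real continuous_on_matrix_matrix_mult continuous_on_transpose G)
  have "bounded_linear (\<lambda>M::real^'n^'n. M *v v)"
    by (rule bounded_bilinear.bounded_linear_left[OF bounded_bilinear_matrix_vector_mult])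
  from integral_linear[OF int this]
  have Wv: "W *v v = integral {a..b} (\<lambda>s. transpose (G s) *v (G s *v v))"
    and intv: "(\<lambda>s. transpose (G s) *v (G s *v v)) integrable_on {a..b}"
    using integrable_linear[OF int \<open>bounded_linear (\<lambda>M::real^'n^'n. M *v v)\<close>]
    by (simp_all add: W_def o_def matrix_vector_mul_assoc del: transpose_matrix_vector)
  have vWv: "v \<bullet> (W *v v) = integral {a..b} (\<lambda>s. (G s *v v) \<bullet> (G s *v v))"
  proof -
    have "v \<bullet> (W *v v) = integral {a..b} (\<lambda>s. v \<bullet> (transpose (G s) *v (G s *v v)))"
      using integral_linear[OF intv bounded_linear_inner_right[of v]]
      by (simp add: Wv o_def del: transpose_matrix_vector)
    then show ?thesis
      by (simp only: inner_commute[of v] inner_transpose_mult)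
  qed
  have cont: "continuous_on {a..b} (\<lambda>s. (G s *v v) \<bullet> (G s *v v))"
    by (intro continuous_on_inner continuous_on_matrix_vector_mult G continuous_on_const)
  show ?thesis
    unfolding null_space_def W_def[symmetric]
  proof
    assume "v \<in> {v. W *v v = 0}"
    then have "integral {a..b} (\<lambda>s. (G s *v v) \<bullet> (G s *v v)) = 0" using vWv by simp
    then show "\<forall>s\<in>{a..b}. G s *v v = 0"
      using integral_eq_0_iff[OF cont ab] by simp
  next
    assume "\<forall>s\<in>{a..b}. G s *v v = 0"
    then have "integral {a..b} (\<lambda>s. transpose (G s) *v (G s *v v)) = integral {a..b} (\<lambda>s. 0)"
      by (intro integral_cong) simp
    then show "v \<in> {v. W *v v = 0}" by (simp add: Wv)
  qed
qed

section \<open>The criterion for periodic solvability\<close>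

theorem mainTheorem1:
  fixes \<omega> :: real
    and A :: "real \<Rightarrow> real^'n^'n"
    and B :: "real \<Rightarrow> real^'r^'n"
    and H :: "real \<Rightarrow> real^'n^'m"
    and l h :: "real \<Rightarrow> real^'n"
    and \<Phi> :: "real \<Rightarrow> real \<Rightarrow> real^'n^'n"
    and P W :: "real^'n^'n"
  assumes "0 < \<omega>"
    and "continuous_on {0..\<omega>} A"
    and "continuous_on {0..\<omega>} B"
    and "continuous_on {0..\<omega>} H"
    and "square_integrable_between 0 \<omega> l"
    and "fundamental_matrix 0 \<omega> (\<lambda>t. - transpose (A t)) \<Phi>"
    and "P = mat 1 - (mat 1 - \<Phi> \<omega> 0) ** pseudoinverse (mat 1 - \<Phi> \<omega> 0)"
    and "W = integral {0..\<omega>} (\<lambda>s.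
           P ** \<Phi> \<omega> s ** transpose (H s) ** H s ** transpose (\<Phi> \<omega> s) ** P)"
    and "ae_solution 0 \<omega> h (\<lambda>t. - transpose (A t) *v h t + l t)"
    and "h 0 = 0"
  shows "(\<exists>z p.
           ae_solution 0 \<omega> z (\<lambda>t. - transpose (A t) *v z t + (transpose (H t) ** H t) *v p t - l t) \<and>
           ae_solution 0 \<omega> p (\<lambda>t. A t *v p t + (B t ** transpose (B t)) *v z t) \<and>
           z 0 = z \<omega> \<and> p 0 = p \<omega>)
         \<longleftrightarrow> (\<forall>v\<in>null_space W. orthogonal (P *v h \<omega>) v)"
proof -
  note A = \<open>continuous_on {0..\<omega>} A\<close> and B = \<open>continuous_on {0..\<omega>} B\<close> and H = \<open>continuous_on {0..\<omega>} H\<close>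
  note \<Phi> = \<open>fundamental_matrix 0 \<omega> (\<lambda>t. - transpose (A t)) \<Phi>\<close>
  note hsol = \<open>ae_solution 0 \<omega> h (\<lambda>t. - transpose (A t) *v h t + l t)\<close>
  let ?M = "mat 1 - \<Phi> \<omega> 0"
  let ?Q = "\<lambda>t. transpose (H t) ** H t" and ?R = "\<lambda>t. B t ** transpose (B t)"
  have I: "0 \<in> {0..\<omega>}" "\<omega> \<in> {0..\<omega>}" using \<open>0 < \<omega>\<close> by auto
  have P: "transpose P = P" "\<And>v. transpose ?M *v (P *v v) = 0" "\<And>q. transpose ?M *v q = 0 \<Longrightarrow> P *v q = q"
    using transpose_pseudoinverse_complement[of ?M] \<open>P = _\<close> by blast+
  have M: "transpose ?M *v q = q - transpose (\<Phi> \<omega> 0) *v q" for q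
  proof -
    have "transpose ?M = mat 1 - transpose (\<Phi> \<omega> 0)"
      by (simp add: vec_eq_iff transpose_def mat_def)
    then show ?thesis by (simp only: matrix_vector_mult_diff_rdistrib matrix_vector_mul_lid)
  qed
  \<comment> \<open>Self-adjointness moves \<open>P\<close> to the other side: the condition
    concerns the vectors \<open>P *v v\<close> with \<open>v\<close> in the null space of
    \<open>W\<close>.\<close>
  have orth_iff: "orthogonal (P *v x) v \<longleftrightarrow> x \<bullet> (P *v v) = 0" for x v
    using inner_transpose_mult[of P x v] P(1) by (simp only: orthogonal_def)
  \<comment> \<open>Since \<open>P\<close> is symmetric, \<open>W\<close> is the Gramian integral of
    this \<open>G\<close>.\<close>
  define G where "G s = H s ** transpose (\<Phi> \<omega> s) ** P" for s
  have "W = integral {0..\<omega>} (\<lambda>s. transpose (G s) ** G s)"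
    unfolding \<open>W = _\<close> G_def
    by (simp add: matrix_transpose_mul matrix_mul_assoc P(1))
  moreover have "continuous_on {0..\<omega>} G"
    unfolding G_def by (intro continuous_on_matrix_matrix_mult continuous_on_transpose
      continuous_on_fundamental_matrix_snd[OF \<Phi> A] H continuous_on_const)
  ultimately have W: "v \<in> null_space W \<longleftrightarrow> (\<forall>s\<in>{0..\<omega>}. H s *v (transpose (\<Phi> \<omega> s) *v (P *v v)) = 0)" for v
    using null_space_gram_integral[OF \<open>0 < \<omega>\<close>, of G v]
    by (simp add: G_def matrix_vector_mul_assoc matrix_mul_assoc del: transpose_matrix_vector)
  have ch: "continuous_on {0..\<omega>} h"
    using hsol absolutely_continuous_between_imp_continuous_on unfolding ae_solution_def by blast
  have cQ: "continuous_on {0..\<omega>} ?Q" and cR: "continuous_on {0..\<omega>} ?R"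
    by (intro continuous_on_matrix_matrix_mult continuous_on_transpose H B)+
  have cA': "continuous_on {0..\<omega>} (\<lambda>t. - transpose (A t))"
    by (intro continuous_intros continuous_on_transpose A)
  show ?thesis
  proof (intro iffI ballI)
    fix v assume "v \<in> null_space W"
      and "\<exists>z p. ae_solution 0 \<omega> z (\<lambda>t. - transpose (A t) *v z t + ?Q t *v p t - l t) \<and>
        ae_solution 0 \<omega> p (\<lambda>t. A t *v p t + ?R t *v z t) \<and> z 0 = z \<omega> \<and> p 0 = p \<omega>"
    then obtain z p where z: "ae_solution 0 \<omega> z (\<lambda>t. - transpose (A t) *v z t + ?Q t *v p t - l t)"
      and p: "ae_solution 0 \<omega> p (\<lambda>t. A t *v p t + ?R t *v z t)" and per: "z 0 = z \<omega>"
      by blast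
    define \<pi> where "\<pi> s = transpose (\<Phi> \<omega> s) *v (P *v v)" for s
    have \<pi>: "(\<pi> has_vector_derivative A t *v \<pi> t) (at t within {0..\<omega>})" if "t \<in> {0..\<omega>}" for t
      unfolding \<pi>_def[abs_def] by (rule fundamental_matrix_adjoint[OF \<Phi> A that])
    have H\<pi>: "H t *v \<pi> t = 0" if "t \<in> {0..\<omega>}" for t
      using \<open>v \<in> null_space W\<close> that unfolding W \<pi>_def by blast
    \<comment> \<open>\<open>P *v v\<close> is annihilated by \<open>transpose ?M\<close>, hence
      fixed by the transpose of \<open>\<Phi> \<omega> 0\<close>; so \<pi> takes the same value at
      both endpoints.\<close>
    have \<pi>0: "\<pi> 0 = P *v v"
      using P(2)[of v] M[of "P *v v"] by (simp add: \<pi>_def del: transpose_matrix_vector)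
    have \<pi>\<omega>: "\<pi> \<omega> = P *v v"
      using \<Phi> I by (simp add: \<pi>_def fundamental_matrix_def del: transpose_matrix_vector)
    define y where "y t = z t + h t" for t
    have "ae_solution 0 \<omega> y (\<lambda>t. (- transpose (A t) *v z t + ?Q t *v p t - l t) + (- transpose (A t) *v h t + l t))"
      unfolding y_def[abs_def] by (rule ae_solution_add[OF z hsol])
    then have ysol: "ae_solution 0 \<omega> y (\<lambda>t. - transpose (A t) *v y t + ?Q t *v p t)"
      by (simp add: y_def matrix_vector_right_distrib algebra_simps del: transpose_matrix_vector)
    have "continuous_on {0..\<omega>} y" "continuous_on {0..\<omega>} p"
      using ysol p absolutely_continuous_between_imp_continuous_on
      unfolding ae_solution_def by blast+
    \<comment> \<open>The right-hand side for \<open>y\<close> no longer contains \<open>l\<close>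
      and is continuous, so the derivative exists at every point.\<close>
    with ysol have y: "(y has_vector_derivative - transpose (A t) *v y t + ?Q t *v p t) (at t within {0..\<omega>})"
      if "t \<in> {0..\<omega>}" for t
      using that by (intro ae_solution_continuous_rhs continuous_on_add continuous_on_matrix_vector_mult cA' cQ)
    have "y \<omega> \<bullet> \<pi> \<omega> = y 0 \<bullet> \<pi> 0"
    proof (rule inner_eq_if_derivative_zero[OF y \<pi> _ I(2,1)])
      fix t assume t: "t \<in> {0..\<omega>}"
      have "(?Q t *v p t) \<bullet> \<pi> t = (H t *v p t) \<bullet> (H t *v \<pi> t)"
        by (simp only: matrix_vector_mul_assoc[symmetric] inner_transpose_mult)
      then show "y t \<bullet> (A t *v \<pi> t) + (- transpose (A t) *v y t + ?Q t *v p t) \<bullet> \<pi> t = 0"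
        using H\<pi>[OF t]
        by (simp add: inner_add_left inner_diff_left uminus_matrix_vector_mult inner_transpose_mult del: transpose_matrix_vector)
    qed
    \<comment> \<open>Periodicity of \<open>z\<close> and \<open>h 0 = 0\<close> make the jump of
      \<open>y\<close> equal to \<open>h \<omega>\<close>.\<close>
    then have "h \<omega> \<bullet> (P *v v) = 0"
      by (simp add: y_def \<pi>0 \<pi>\<omega> inner_add_left per \<open>h 0 = 0\<close>)
    then show "orthogonal (P *v h \<omega>) v" by (simp only: orth_iff)
  next
    assume orth: "\<forall>v\<in>null_space W. orthogonal (P *v h \<omega>) v"
    \<comment> \<open>Writing \<open>z = y - h\<close> in the equation for \<open>p\<close> creates
      the forcing \<open>- (?R t *v h t)\<close>; the equation for \<open>y\<close> has
      none.\<close>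
    have cg: "continuous_on {0..\<omega>} (\<lambda>t. - (?R t *v h t))"
      by (intro continuous_on_minus continuous_on_matrix_vector_mult cR ch)
    \<comment> \<open>Both sides vanish: the integrand because the transpose of \<open>B t\<close>
      annihilates \<zeta>, the boundary term by the orthogonality assumption.\<close>
    have compat: "((\<lambda>t. 0 \<bullet> \<pi> t - (- (?R t *v h t)) \<bullet> \<zeta> t) has_integral h \<omega> \<bullet> \<pi> \<omega> - 0 \<bullet> \<zeta> \<omega>) {0..\<omega>}"
      if hom: "hamiltonian_solution 0 \<omega> A ?Q ?R (\<lambda>_. 0) (\<lambda>_. 0) \<zeta> \<pi>" and per: "\<zeta> 0 = \<zeta> \<omega>" "\<pi> 0 = \<pi> \<omega>"
      for \<zeta> \<pi>
    proof -
      note deg = hamiltonian_periodic_degenerate[OF \<open>0 < \<omega>\<close> B H hom per]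
      have \<pi>: "(\<pi> has_vector_derivative A t *v \<pi> t) (at t within {0..\<omega>})" if "t \<in> {0..\<omega>}" for t
      proof -
        have "?R t *v \<zeta> t = 0"
          using deg(2)[OF that] by (simp only: matrix_vector_mul_assoc[symmetric] matrix_vector_mult_0_right)
        then show ?thesis using hom that unfolding hamiltonian_solution_def by force
      qed
      note \<Phi>\<pi> = fundamental_matrix_transpose_solution[OF \<Phi> \<pi>]
      \<comment> \<open>Periodicity says that the transpose of \<open>\<Phi> \<omega> 0\<close>
        fixes \<open>\<pi> \<omega>\<close>, so this vector lies in the range of \<open>P\<close>
        and can itself be tested for membership in the null space of \<open>W\<close>.\<close>
      have "P *v \<pi> \<omega> = \<pi> \<omega>"
        by (rule P(3)) (simp only: M \<Phi>\<pi>[OF _ I(1)] per, simp)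
      moreover from this have "\<pi> \<omega> \<in> null_space W"
        unfolding W using deg(1) \<Phi>\<pi> by (simp del: transpose_matrix_vector)
      ultimately have "h \<omega> \<bullet> \<pi> \<omega> = 0" using orth orth_iff by metis
      moreover have "(?R t *v h t) \<bullet> \<zeta> t = 0" if "t \<in> {0..\<omega>}" for t
      proof -
        have "(?R t *v h t) \<bullet> \<zeta> t = (transpose (B t) *v h t) \<bullet> (transpose (B t) *v \<zeta> t)"
          by (metis inner_commute inner_transpose_mult matrix_vector_mul_assoc)
        then show ?thesis using deg(2)[OF that] by (simp del: transpose_matrix_vector)
      qed
      ultimately show ?thesis
        using has_integral_is_0[of "{0..\<omega>}" "\<lambda>t. 0 \<bullet> \<pi> t - (- (?R t *v h t)) \<bullet> \<zeta> t"]
        by (simp add: inner_minus_left)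
    qed
    have sym: "transpose (?Q t) = ?Q t" "transpose (?R t) = ?R t" for t
      by (simp_all add: matrix_transpose_mul)
    obtain y p where yp: "hamiltonian_solution 0 \<omega> A ?Q ?R (\<lambda>_. 0) (\<lambda>t. - (?R t *v h t)) y p"
        "y \<omega> - y 0 = h \<omega>" "p \<omega> - p 0 = 0"
      using hamiltonian_jump_solvable[OF less_imp_le[OF \<open>0 < \<omega>\<close>] A cQ cR continuous_on_const cg sym compat]
      by blast
    have dy: "(y has_vector_derivative - transpose (A t) *v y t + ?Q t *v p t) (at t within {0..\<omega>})"
      and dp: "(p has_vector_derivative A t *v p t + ?R t *v (y t - h t)) (at t within {0..\<omega>})"
      if "t \<in> {0..\<omega>}" for t
      using yp(1) that unfolding hamiltonian_solution_def
      by (simp_all add: matrix_vector_mult_diff_distrib add_diff_eq del: transpose_matrix_vector)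
    have cy: "continuous_on {0..\<omega>} y" and cp: "continuous_on {0..\<omega>} p"
      unfolding continuous_on_eq_continuous_within
      using dy dp has_vector_derivative_continuous by blast+
    have "ae_solution 0 \<omega> y (\<lambda>t. - transpose (A t) *v y t + ?Q t *v p t)"
      by (intro ae_solution_C1 dy continuous_on_add continuous_on_matrix_vector_mult cA' cQ cy cp)
    \<comment> \<open>Subtracting \<open>h\<close> restores the forcing \<open>l\<close> and turns
      the jump \<open>h \<omega>\<close> of \<open>y\<close> into periodicity.\<close>
    from ae_solution_diff[OF this hsol]
    have "ae_solution 0 \<omega> (\<lambda>t. y t - h t) (\<lambda>t. - transpose (A t) *v (y t - h t) + ?Q t *v p t - l t)"
      by (simp add: matrix_vector_mult_diff_distrib algebra_simps del: transpose_matrix_vector)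
    moreover have "ae_solution 0 \<omega> p (\<lambda>t. A t *v p t + ?R t *v (y t - h t))"
      by (intro ae_solution_C1 dp continuous_on_add continuous_on_diff continuous_on_matrix_vector_mult A cR cy cp ch)
    moreover have "y 0 - h 0 = y \<omega> - h \<omega>" "p 0 = p \<omega>"
      using yp(2,3) \<open>h 0 = 0\<close> by (auto simp: algebra_simps)
    ultimately show "\<exists>z p. ae_solution 0 \<omega> z (\<lambda>t. - transpose (A t) *v z t + ?Q t *v p t - l t) \<and>
        ae_solution 0 \<omega> p (\<lambda>t. A t *v p t + ?R t *v z t) \<and> z 0 = z \<omega> \<and> p 0 = p \<omega>"
      by (intro exI[of _ "\<lambda>t. y t - h t"] exI[of _ p]) simp
  qed
qed

end
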